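(* Let $w=(w_1,\dots,w_n)\in(0,1]^n$ be such that $\Delta_{0,w}$ is a path space. Then the forgetful map $\phi:\widetilde\Delta_{0,w}\to\Delta_{0,w}$ is a double cover. Moreover, $\widetilde\Delta_{0,w}$ is isomorphic as a simplicial complex to the flag (order) complex of the subposet $P$ of the Boolean lattice of subsets of $\{1,\dots,n\}$ consisting of all $A\subseteq\{1,\dots,n\}$ with $\sum_{i\in A}w_i>1$ and $\sum_{i\notin A}w_i>1$, ordered by inclusion.
   Context: For a weight vector $w\in(0,1]^n$ with $\sum w_i>2$, a $w$-stable $n$-marked tree is a finite tree $T$ with a marking $m_T:\{1,\dots,n\}\to V(T)$ such that every vertex has (number of edges) $+$ (sum of weights of marks at it) $>2$; $\Delta_{0,w}$ is the simplicial complex of such trees with positive edge lengths summing to $1$, one simplex $\{\ell\in\mathbf{R}_{\ge0}^{E(T)}:\sum\ell_e=1\}$ per tree, faces with vanishing lengths identified with the simplices of contracted trees. $\Delta_{0,w}$ is a path space if every $w$-stable tree is a path, i.e. has exactly two leaves (equivalently, there is no partition $\{1,\dots,n\}=\alpha\sqcup\beta\sqcup\gamma$ with each part of weight $>1$). An orientation of a path is an injective assignment of the labels $\mathbf L,\mathbf R$ to its two leaves; $\widetilde\Delta_{0,w}$ is the moduli space of oriented such paths of total length $1$, with the cell structure defined as for $\Delta_{0,w}$ (orientations carried along edge contractions), and $\phi$ forgets the orientation. *)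

theory Defs
  imports "HOL-Analysis.Analysis"
begin

section \<open>Gluing simplices\<close>

text \<open>A point of the standard simplex on \<open>E\<close> is a function vanishing outside \<open>E\<close>; its
  topology is induced by the product topology on functions.\<close>

definition std_simplex :: "'e set \<Rightarrow> ('e \<Rightarrow> real) set" where
  "std_simplex E = {l. (\<forall>e. 0 \<le> l e) \<and> (\<forall>e. e \<notin> E \<longrightarrow> l e = 0) \<and> sum l E = 1}"

text \<open>One simplex \<open>std_simplex (E T)\<close> is given for each index \<open>T \<in> S\<close>. The pairs in \<open>R\<close> say which
  points \<open>(T, l)\<close>, \<open>(T', l')\<close> are to be identified; the points of the glued space are the classes
  of the equivalence relation generated by \<open>R\<close>.\<close>

definition glued_class :: "(('t \<times> ('e \<Rightarrow> real)) \<times> ('t \<times> ('e \<Rightarrow> real))) set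
    \<Rightarrow> 't \<times> ('e \<Rightarrow> real) \<Rightarrow> ('t \<times> ('e \<Rightarrow> real)) set" where
  "glued_class R p = ((R \<union> R\<inverse>)\<^sup>*) `` {p}"

definition glued_open :: "'t set \<Rightarrow> ('t \<Rightarrow> 'e set)
    \<Rightarrow> (('t \<times> ('e \<Rightarrow> real)) \<times> ('t \<times> ('e \<Rightarrow> real))) set
    \<Rightarrow> ('t \<times> ('e \<Rightarrow> real)) set set \<Rightarrow> bool" where
  "glued_open S E R U \<longleftrightarrow>
     U \<subseteq> glued_class R ` (SIGMA T:S. std_simplex (E T)) \<and>
     (\<forall>T\<in>S. openin (top_of_set (std_simplex (E T)))
               {l \<in> std_simplex (E T). glued_class R (T, l) \<in> U})"

definition glued_space :: "'t set \<Rightarrow> ('t \<Rightarrow> 'e set)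
    \<Rightarrow> (('t \<times> ('e \<Rightarrow> real)) \<times> ('t \<times> ('e \<Rightarrow> real))) set
    \<Rightarrow> ('t \<times> ('e \<Rightarrow> real)) set topology" where
  "glued_space S E R = topology (glued_open S E R)"

lemma istopology_glued_open: "istopology (glued_open S E R)"
  unfolding istopology_def
proof (intro conjI allI impI)
  fix U V assume U: "glued_open S E R U" and V: "glued_open S E R V"
  have "{l \<in> std_simplex (E T). glued_class R (T, l) \<in> U \<inter> V}
      = {l \<in> std_simplex (E T). glued_class R (T, l) \<in> U} \<inter>
        {l \<in> std_simplex (E T). glued_class R (T, l) \<in> V}" for T
    by blast
  with U V show "glued_open S E R (U \<inter> V)"
    unfolding glued_open_def by (simp add: le_infI1 openin_Int)
next
  fix \<K> assume K: "\<forall>K\<in>\<K>. glued_open S E R K"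
  have "{l \<in> std_simplex (E T). glued_class R (T, l) \<in> \<Union>\<K>}
      = (\<Union>K\<in>\<K>. {l \<in> std_simplex (E T). glued_class R (T, l) \<in> K})" for T
    by blast
  moreover have "\<Union>\<K> \<subseteq> glued_class R ` (SIGMA T:S. std_simplex (E T))"
    using K unfolding glued_open_def by blast
  moreover have "openin (top_of_set (std_simplex (E T)))
      (\<Union>K\<in>\<K>. {l \<in> std_simplex (E T). glued_class R (T, l) \<in> K})" if "T \<in> S" for T
    using K that unfolding glued_open_def by (intro openin_Union) blast
  ultimately show "glued_open S E R (\<Union>\<K>)"
    unfolding glued_open_def by presburger
qed

lemma openin_glued_space: "openin (glued_space S E R) = glued_open S E R"
  unfolding glued_space_def by (simp add: istopology_glued_open)

lemma topspace_glued_space: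
  "topspace (glued_space S E R) = glued_class R ` (SIGMA T:S. std_simplex (E T))"
    (is "_ = ?C")
proof
  show "topspace (glued_space S E R) \<subseteq> ?C"
    by (metis glued_open_def openin_glued_space openin_topspace)
  have "{l \<in> std_simplex (E T). glued_class R (T, l) \<in> ?C} = std_simplex (E T)" if "T \<in> S" for T
    using that by blast
  then have "glued_open S E R ?C"
    unfolding glued_open_def by simp
  then show "?C \<subseteq> topspace (glued_space S E R)"
    by (metis openin_glued_space openin_subset)
qed

section \<open>Abstract simplicial complexes and their realizations\<close>

text \<open>The complex \<open>K\<close> is given by its nonempty simplices. Only finite complexes are used here, so
  there is no need to distinguish the coherent topology from the product topology.\<close>

definition realization :: "'v set set \<Rightarrow> ('v \<Rightarrow> real) topology" where
  "realization K = top_of_set (\<Union>\<sigma>\<in>K. std_simplex \<sigma>)"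

definition order_complex :: "'a set set \<Rightarrow> 'a set set set" where
  "order_complex P = {\<sigma>. \<sigma> \<noteq> {} \<and> finite \<sigma> \<and> \<sigma> \<in> chains P}"

text \<open>A homeomorphism onto the realization of \<open>K\<close> that maps each nonempty simplex affinely onto a
  simplex of \<open>K\<close>, along a bijection \<open>\<beta> T\<close> of the vertices (the vertices of the simplex of \<open>T\<close> are
  indexed by \<open>E T\<close>), and that reaches every simplex of \<open>K\<close>. The equation for barycentric
  coordinates at \<open>\<beta> T e\<close> determines \<open>h\<close> on the simplex of \<open>T\<close>, because coordinates are nonnegative
  and sum to 1.\<close>

definition simplicial_iso :: "'t set \<Rightarrow> ('t \<Rightarrow> 'e set)
    \<Rightarrow> (('t \<times> ('e \<Rightarrow> real)) \<times> ('t \<times> ('e \<Rightarrow> real))) set \<Rightarrow> 'v set set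
    \<Rightarrow> (('t \<times> ('e \<Rightarrow> real)) set \<Rightarrow> 'v \<Rightarrow> real) \<Rightarrow> bool" where
  "simplicial_iso S E R K h \<longleftrightarrow>
     homeomorphic_map (glued_space S E R) (realization K) h \<and>
     (\<exists>\<beta>. (\<forall>T\<in>S. E T \<noteq> {} \<longrightarrow>
              inj_on (\<beta> T) (E T) \<and> \<beta> T ` E T \<in> K \<and>
              (\<forall>l\<in>std_simplex (E T). \<forall>e\<in>E T. h (glued_class R (T, l)) (\<beta> T e) = l e)) \<and>
          (\<forall>\<sigma>\<in>K. \<exists>T\<in>S. E T \<noteq> {} \<and> \<beta> T ` E T = \<sigma>))"

section \<open>Double covers\<close>

text \<open>The library's \<^const>\<open>covering_space\<close> is about subsets of type class topologies; this is
  the same notion for abstract topologies, with two points in each fibre.\<close>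

definition double_cover :: "'a topology \<Rightarrow> 'b topology \<Rightarrow> ('a \<Rightarrow> 'b) \<Rightarrow> bool" where
  "double_cover X Y p \<longleftrightarrow>
     continuous_map X Y p \<and> p ` topspace X = topspace Y \<and>
     (\<forall>y\<in>topspace Y. \<exists>U. y \<in> U \<and> openin Y U \<and>
        (\<exists>\<V>. \<Union>\<V> = {x \<in> topspace X. p x \<in> U} \<and>
             (\<forall>V\<in>\<V>. openin X V) \<and> pairwise disjnt \<V> \<and>
             (\<forall>V\<in>\<V>. homeomorphic_map (subtopology X V) (subtopology Y U) p))) \<and>
     (\<forall>y\<in>topspace Y. card {x \<in> topspace X. p x = y} = 2)"

section \<open>Stable marked trees\<close>

text \<open>Vertices are natural numbers, edges are two-element sets of vertices. Every finite tree is
  isomorphic to one of this form, and isomorphic trees are identified below. Only the values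
  of the marking on \<open>{1..n}\<close> matter.\<close>

record mtree =
  verts :: "nat set"
  edges :: "nat set set"
  mark :: "nat \<Rightarrow> nat"

definition connected_by :: "nat set set \<Rightarrow> (nat \<times> nat) set" where
  "connected_by F = {(u, v). {u, v} \<in> F}\<^sup>*"

definition cycle :: "nat set set \<Rightarrow> nat list \<Rightarrow> bool" where
  "cycle F p \<longleftrightarrow> 3 \<le> length p \<and> distinct p \<and>
     (\<forall>i<length p. {p ! i, p ! (Suc i mod length p)} \<in> F)"

definition marked_tree :: "nat \<Rightarrow> mtree \<Rightarrow> bool" where
  "marked_tree n T \<longleftrightarrow>
     finite (verts T) \<and> verts T \<noteq> {} \<and>
     (\<forall>e\<in>edges T. e \<subseteq> verts T \<and> card e = 2) \<and>
     verts T \<times> verts T \<subseteq> connected_by (edges T) \<and>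
     (\<nexists>p. cycle (edges T) p) \<and>
     mark T ` {1..n} \<subseteq> verts T"

definition valence :: "mtree \<Rightarrow> nat \<Rightarrow> nat" where
  "valence T v = card {e \<in> edges T. v \<in> e}"

definition stable_trees :: "nat \<Rightarrow> (nat \<Rightarrow> real) \<Rightarrow> mtree set" where
  "stable_trees n w = {T. marked_tree n T \<and>
     (\<forall>v\<in>verts T. real (valence T v) + sum w {i \<in> {1..n}. mark T i = v} > 2)}"

definition leaves :: "mtree \<Rightarrow> nat set" where
  "leaves T = {v \<in> verts T. valence T v = 1}"

text \<open>\<open>c\<close> exhibits \<open>T'\<close> as \<open>T\<close> with the edges in \<open>F\<close> contracted; for \<open>F = {}\<close> this says that
  \<open>c\<close> is an isomorphism of marked trees.\<close>

definition contraction :: "nat \<Rightarrow> mtree \<Rightarrow> nat set set \<Rightarrow> mtree \<Rightarrow> (nat \<Rightarrow> nat) \<Rightarrow> bool" where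
  "contraction n T F T' c \<longleftrightarrow>
     F \<subseteq> edges T \<and> c ` verts T = verts T' \<and>
     (\<forall>u\<in>verts T. \<forall>v\<in>verts T. c u = c v \<longleftrightarrow> (u, v) \<in> connected_by F) \<and>
     edges T' = (\<lambda>e. c ` e) ` (edges T - F) \<and>
     (\<forall>i\<in>{1..n}. mark T' i = c (mark T i))"

section \<open>The moduli spaces\<close>

definition glue :: "nat \<Rightarrow> (nat \<Rightarrow> real)
    \<Rightarrow> ((mtree \<times> (nat set \<Rightarrow> real)) \<times> (mtree \<times> (nat set \<Rightarrow> real))) set" where
  "glue n w = {((T, l), (T', l')).
     T \<in> stable_trees n w \<and> l \<in> std_simplex (edges T) \<and>
     T' \<in> stable_trees n w \<and> l' \<in> std_simplex (edges T') \<and>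
     (\<exists>F c. contraction n T F T' c \<and> (\<forall>e\<in>F. l e = 0) \<and> (\<forall>e\<in>edges T - F. l' (c ` e) = l e))}"

definition Delta :: "nat \<Rightarrow> (nat \<Rightarrow> real) \<Rightarrow> (mtree \<times> (nat set \<Rightarrow> real)) set topology" where
  "Delta n w = glued_space (stable_trees n w) edges (glue n w)"

text \<open>The tree with a single vertex is always stable; it carries no length function of total
  length 1 and contributes the empty simplex, so it is left out here.\<close>

definition path_space :: "nat \<Rightarrow> (nat \<Rightarrow> real) \<Rightarrow> bool" where
  "path_space n w \<longleftrightarrow> (\<forall>T\<in>stable_trees n w. edges T \<noteq> {} \<longrightarrow> card (leaves T) = 2)"

datatype label = LabelL | LabelR

text \<open>An orientation is recorded as the map from the labels to the leaves carrying them.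
  The two labels exhaust the leaves, so the tree is a path.\<close>

type_synonym otree = "mtree \<times> (label \<Rightarrow> nat)"

definition oriented_paths :: "nat \<Rightarrow> (nat \<Rightarrow> real) \<Rightarrow> otree set" where
  "oriented_paths n w = {(T, r). T \<in> stable_trees n w \<and> inj r \<and> range r = leaves T}"

definition oglue :: "nat \<Rightarrow> (nat \<Rightarrow> real)
    \<Rightarrow> ((otree \<times> (nat set \<Rightarrow> real)) \<times> (otree \<times> (nat set \<Rightarrow> real))) set" where
  "oglue n w = {(((T, r), l), ((T', r'), l')).
     (T, r) \<in> oriented_paths n w \<and> l \<in> std_simplex (edges T) \<and>
     (T', r') \<in> oriented_paths n w \<and> l' \<in> std_simplex (edges T') \<and>
     (\<exists>F c. contraction n T F T' c \<and> (\<forall>x. r' x = c (r x)) \<and>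
        (\<forall>e\<in>F. l e = 0) \<and> (\<forall>e\<in>edges T - F. l' (c ` e) = l e))}"

abbreviation oedges :: "otree \<Rightarrow> nat set set" where
  "oedges T \<equiv> edges (fst T)"

definition oriented_Delta :: "nat \<Rightarrow> (nat \<Rightarrow> real) \<Rightarrow> (otree \<times> (nat set \<Rightarrow> real)) set topology" where
  "oriented_Delta n w = glued_space (oriented_paths n w) oedges (oglue n w)"

text \<open>The map induced by \<open>((T, r), l) \<mapsto> (T, l)\<close> on classes; the union is over
  representatives of \<open>X\<close>, which all give the same class.\<close>

definition forget :: "nat \<Rightarrow> (nat \<Rightarrow> real)
    \<Rightarrow> (otree \<times> (nat set \<Rightarrow> real)) set \<Rightarrow> (mtree \<times> (nat set \<Rightarrow> real)) set" where
  "forget n w X = (\<Union>((T, r), l)\<in>X. glued_class (glue n w) (T, l))"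

definition heavy_subsets :: "nat \<Rightarrow> (nat \<Rightarrow> real) \<Rightarrow> nat set set" where
  "heavy_subsets n w = {A. A \<subseteq> {1..n} \<and> sum w A > 1 \<and> sum w ({1..n} - A) > 1}"

end

theory Submission
  imports Defs
begin

text \<open>Removing an edge of an oriented path splits the marks into a left and a right part. The left
  parts of the edges form a chain of subsets, which are heavy on both sides because a leaf carries
  weight greater than 1; the inclusions are strict because every interior vertex carries a mark.
  Contracting an edge drops one subset from the chain and keeps the others, so the lengths of
  the edges, indexed by their left parts, are well-defined barycentric coordinates on the moduli
  space. Conversely, a chain determines a path, and contracting the edges of length zero brings every
  point to the path of the chain supporting its coordinates.

  Reversing the orientation replaces the subsets by their complements. A set and its complement
  never lie in the same chain of heavy subsets, so the open stars of the vertices \<open>A\<close> and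
  \<open>{1..n} - A\<close> are disjoint; together they are the preimage of an open set that each of them covers
  homeomorphically.\<close>

section \<open>Walks in trees\<close>

text \<open>Points are classes of a generated equivalence relation, so equality of two points is a
  question about zigzags of contractions. On the oriented side an invariant and a normal form settle
  it: \<open>bary\<close> does not change along an identification, and each point is glued in a
  single step to a \<open>chain_point\<close> that is a function of its \<open>bary\<close> alone.
  On the unoriented side a zigzag is lifted to orientations instead. A contraction of a path creates
  no leaf other than the images of the two ends; in a path space the contracted tree again has two
  leaves, so both ends survive as distinct leaves and an orientation can be carried along an
  identification in either direction. Hence a fibre has at most two points, and the coordinates tell
  the two apart. The glued space has a quotient topology and the realization a subspace topology.
  They are compared through the finiteness of the complex: openness in a finite union of closed
  simplices can be tested on each of them, and there the coordinate map has an explicit continuous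
  inverse.\<close>

abbreviation walk :: "nat set set \<Rightarrow> nat list \<Rightarrow> bool" where
  "walk F \<equiv> successively (\<lambda>u v. {u, v} \<in> F)"

lemma connected_by_refl [simp]: "(u, u) \<in> connected_by F"
  unfolding connected_by_def by simp

lemma connected_by_edge: "{u, v} \<in> F \<Longrightarrow> (u, v) \<in> connected_by F"
  unfolding connected_by_def by auto

lemma connected_by_trans:
  "(u, v) \<in> connected_by F \<Longrightarrow> (v, x) \<in> connected_by F \<Longrightarrow> (u, x) \<in> connected_by F"
  unfolding connected_by_def by (rule rtrancl_trans)

lemma connected_by_sym: "(u, v) \<in> connected_by F \<Longrightarrow> (v, u) \<in> connected_by F"
proof -
  have "sym {(u, v). {u, v} \<in> F}"
    by (auto simp: sym_def insert_commute)
  then have "sym (connected_by F)"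
    unfolding connected_by_def by (rule sym_rtrancl)
  then show "(u, v) \<in> connected_by F \<Longrightarrow> (v, u) \<in> connected_by F"
    by (rule symD)
qed

lemma connected_by_mono: "F \<subseteq> G \<Longrightarrow> (u, v) \<in> connected_by F \<Longrightarrow> (u, v) \<in> connected_by G"
  unfolding connected_by_def by (erule rtrancl_mono[THEN subsetD, rotated]) auto

lemma connected_by_induct [consumes 1, case_names refl step]:
  assumes "(u, v) \<in> connected_by F" and "P u"
    and "\<And>x y. (u, x) \<in> connected_by F \<Longrightarrow> {x, y} \<in> F \<Longrightarrow> P x \<Longrightarrow> P y"
  shows "P v"
  using assms(1) unfolding connected_by_def
  by (induction rule: rtrancl_induct) (use assms in \<open>auto simp: connected_by_def\<close>)

lemma walk_connected_by:
  assumes "walk F p" and "u \<in> set p" and "v \<in> set p"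
  shows "(u, v) \<in> connected_by F"
proof -
  have *: "(hd p, x) \<in> connected_by F" if "walk F p" "x \<in> set p" for p x
    using that
  proof (induction p rule: induct_list012)
    case (3 a b p)
    show ?case
    proof (cases "x = a")
      case False
      with 3 have "(b, x) \<in> connected_by F" by auto
      moreover have "(a, b) \<in> connected_by F"
        using 3 by (simp add: connected_by_edge)
      ultimately show ?thesis by (auto intro: connected_by_trans)
    qed auto
  qed auto
  show ?thesis
    using *[OF assms(1,2)] *[OF assms(1,3)] by (blast intro: connected_by_sym connected_by_trans)
qed

lemma connected_by_distinct_walk:
  assumes "(u, v) \<in> connected_by F"
  obtains p where "walk F p" "distinct p" "p \<noteq> []" "hd p = u" "last p = v"
proof -
  have "\<exists>p. walk F p \<and> distinct p \<and> p \<noteq> [] \<and> hd p = u \<and> last p = v"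
    using assms
  proof (induction rule: connected_by_induct)
    case refl
    show ?case by (rule exI[of _ "[u]"]) simp
  next
    case (step x y)
    then obtain p where p: "walk F p" "distinct p" "p \<noteq> []" "hd p = u" "last p = x" by blast
    show ?case
    proof (cases "y \<in> set p")
      case True
      then obtain q q' where "p = q @ y # q'" by (blast dest: split_list)
      then have q: "p = (q @ [y]) @ q'" by simp
      have "walk F (q @ [y])"
        using p(1) unfolding q successively_append_iff by blast
      moreover have "distinct (q @ [y])" "hd (q @ [y]) = u"
        using p unfolding q by (auto simp: hd_append)
      ultimately show ?thesis by (intro exI[of _ "q @ [y]"]) simp
    next
      case False
      with p step.hyps show ?thesis
        by (intro exI[of _ "p @ [y]"]) (auto simp: successively_append_iff)
    qed
  qed
  with that show thesis by blast
qed

lemma cycleI: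
  assumes "walk F p" "distinct p" "3 \<le> length p" "{last p, hd p} \<in> F"
  shows "cycle F p"
proof -
  have "{p ! i, p ! (Suc i mod length p)} \<in> F" if "i < length p" for i
  proof (cases "Suc i < length p")
    case True
    then show ?thesis using assms(1) by (simp add: successively_conv_nth)
  next
    case False
    with that have "Suc i = length p" by simp
    then have "i = length p - 1" "p \<noteq> []" by auto
    with \<open>Suc i = length p\<close> assms(4) show ?thesis
      by (metis hd_conv_nth last_conv_nth mod_self)
  qed
  with assms show ?thesis unfolding cycle_def by blast
qed

text \<open>A detour around the edge without repeated vertices has at least one intermediate vertex,
  so the edge would close it to a cycle.\<close>

lemma bridge:
  assumes "\<nexists>p. cycle E p" and "{u, v} \<in> E" and "u \<noteq> v"
  shows "(u, v) \<notin> connected_by (E - {{u, v}})"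
proof
  assume "(u, v) \<in> connected_by (E - {{u, v}})"
  then obtain p where p: "walk (E - {{u, v}}) p" "distinct p" "p \<noteq> []" "hd p = u" "last p = v"
    by (rule connected_by_distinct_walk)
  have "3 \<le> length p"
  proof (rule ccontr)
    assume "\<not> 3 \<le> length p"
    then have "length p < 3" by simp
    then consider "p = []" | a where "p = [a]" | a b where "p = [a, b]"
      by (auto simp: less_Suc_eq length_Suc_conv numeral_3_eq_3)
    then show False using p assms(3) by cases auto
  qed
  moreover have "walk E p"
    using p(1) by (rule successively_mono) auto
  ultimately have "cycle E p"
    using p assms(2) by (intro cycleI) (auto simp: insert_commute)
  with assms(1) show False by blast
qed

text \<open>A second edge at the last vertex would, by maximality, lead back to an earlier vertex of
  the walk and close a cycle.\<close>

lemma maximal_walk_ends_in_leaf: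
  assumes acyclic: "\<nexists>p. cycle (edges T) p" and card2: "\<forall>e\<in>edges T. card e = 2"
    and p: "walk (edges T) p" "distinct p" "2 \<le> length p"
    and max: "\<And>z. {last p, z} \<in> edges T \<Longrightarrow> z \<in> set p"
  shows "valence T (last p) = 1"
proof -
  obtain q x y where q: "p = q @ [x, y]"
  proof -
    obtain p' y where "p = p' @ [y]" using p(3) by (cases p rule: rev_cases) auto
    moreover from this p(3) obtain q x where "p' = q @ [x]" by (cases p' rule: rev_cases) auto
    ultimately show ?thesis using that by auto
  qed
  have xy: "{x, y} \<in> edges T"
    using p(1) unfolding q by (simp add: successively_append_iff)
  have "e = {x, y}" if e: "e \<in> edges T" "y \<in> e" for e
  proof -
    obtain a b where "e = {a, b}" "a \<noteq> b" using card2 e by (meson card_2_iff)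
    with e that have "\<exists>z. e = {y, z} \<and> z \<noteq> y" by auto
    then obtain z where z: "e = {y, z}" "z \<noteq> y" by blast
    then have "z \<in> set p" using max[of z] e q by simp
    show ?thesis
    proof (cases "z = x")
      case False
      with \<open>z \<in> set p\<close> z q have "z \<in> set q" by auto
      then obtain q1 q2 where "q = q1 @ z # q2" by (metis split_list)
      then have "cycle (edges T) (z # q2 @ [x, y])"
        using p z e q by (intro cycleI) (auto simp: successively_append_iff insert_commute)
      with acyclic show ?thesis by blast
    qed (use z in auto)
  qed
  with xy have "{e \<in> edges T. y \<in> e} = {{x, y}}" by blast
  then show ?thesis unfolding valence_def q by simp
qed

text \<open>Prolong the walk from \<open>u\<close> to \<open>x\<close> as far as possible without
  repetition. Finiteness bounds its length, and acyclicity makes its end a leaf. Since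
  \<open>u\<close> is not repeated, the part from \<open>x\<close> on avoids the edge back to
  \<open>u\<close>. This is the leaf that a branch off a path would produce.\<close>

lemma leaf_beyond_edge:
  assumes fin: "finite (verts T)" and sub: "\<forall>e\<in>edges T. e \<subseteq> verts T \<and> card e = 2"
    and acyclic: "\<nexists>p. cycle (edges T) p" and ux: "{u, x} \<in> edges T"
  obtains y where "y \<in> leaves T" "(x, y) \<in> connected_by (edges T - {{u, x}})"
proof -
  have "u \<noteq> x" using sub ux by force
  define W where "W = {p. walk (edges T) (u # x # p) \<and> distinct (u # x # p)}"
  have "set p \<subseteq> verts T" if "p \<in> W" for p
  proof
    fix z assume "z \<in> set p"
    with that have "(x, z) \<in> connected_by (edges T)"
      unfolding W_def by (intro walk_connected_by[of _ "x # p"]) auto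
    then show "z \<in> verts T"
      using ux sub by (induction rule: connected_by_induct) auto
  qed
  then have "card (set p) \<le> card (verts T)" if "p \<in> W" for p
    using that by (intro card_mono fin)
  moreover have "card (set p) = length p" if "p \<in> W" for p
    using that unfolding W_def by (simp add: distinct_card)
  ultimately have "\<forall>p. p \<in> W \<longrightarrow> length p < Suc (card (verts T))" by (metis le_imp_less_Suc)
  moreover have "[] \<in> W" unfolding W_def using ux \<open>u \<noteq> x\<close> by simp
  ultimately have "\<exists>p. p \<in> W \<and> (\<forall>q. q \<in> W \<longrightarrow> length q \<le> length p)"
    by (intro ex_has_greatest_nat)
  then obtain p where p: "p \<in> W" "\<And>q. q \<in> W \<Longrightarrow> length q \<le> length p" by blast
  let ?p = "u # x # p"
  have pw: "walk (edges T) ?p" "distinct ?p" using p(1) unfolding W_def by auto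
  have "z \<in> set ?p" if "{last ?p, z} \<in> edges T" for z
  proof (rule ccontr)
    assume "z \<notin> set ?p"
    with that pw have "walk (edges T) (?p @ [z])" "distinct (?p @ [z])"
      unfolding successively_append_iff by auto
    then have "p @ [z] \<in> W" unfolding W_def by simp
    then show False using p(2)[of "p @ [z]"] by simp
  qed
  then have "valence T (last ?p) = 1"
    using pw sub acyclic by (intro maximal_walk_ends_in_leaf) auto
  moreover have w: "walk (edges T - {{u, x}}) (x # p)"
  proof -
    have "walk (edges T) (x # p)" using pw by simp
    then show ?thesis
    proof (rule successively_mono)
      fix a b assume "a \<in> set (x # p)" "b \<in> set (x # p)" "{a, b} \<in> edges T"
      with pw show "{a, b} \<in> edges T - {{u, x}}"
        by (auto simp: doubleton_eq_iff)
    qed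
  qed
  moreover have "(x, last ?p) \<in> connected_by (edges T - {{u, x}})"
    using w by (rule walk_connected_by) auto
  moreover from this have "last ?p \<in> verts T"
    by (induction rule: connected_by_induct) (use sub ux in auto)
  ultimately show thesis
    using that unfolding leaves_def by blast
qed

section \<open>Trees with two leaves as vertex lists\<close>

definition path_list :: "mtree \<Rightarrow> nat list \<Rightarrow> bool" where
  "path_list T p \<longleftrightarrow> 2 \<le> length p \<and> distinct p \<and> set p = verts T \<and>
     edges T = {{p ! i, p ! Suc i} | i. Suc i < length p}"

text \<open>Take the walk between the two leaves. An edge leaving it would have a leaf beyond it;
  this leaf is \<open>a\<close> or \<open>b\<close>, hence lies on the walk, which contradicts
  \<open>bridge\<close>. Connectedness then puts every vertex on the walk.\<close>

lemma path_list_exists: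
  assumes T: "marked_tree n T" and ab: "leaves T = {a, b}" "a \<noteq> b"
  obtains p where "path_list T p" "hd p = a" "last p = b"
proof -
  have fin: "finite (verts T)" and sub: "\<forall>e\<in>edges T. e \<subseteq> verts T \<and> card e = 2"
    and conn: "verts T \<times> verts T \<subseteq> connected_by (edges T)"
    and acyclic: "\<nexists>p. cycle (edges T) p"
    using T unfolding marked_tree_def by auto
  have "a \<in> verts T" "b \<in> verts T" using ab unfolding leaves_def by auto
  with conn have "(a, b) \<in> connected_by (edges T)" by auto
  then obtain p where p: "walk (edges T) p" "distinct p" "p \<noteq> []" "hd p = a" "last p = b"
    by (rule connected_by_distinct_walk)
  have a: "a \<in> set p" and b: "b \<in> set p" using p by auto
  have closed: "x \<in> set p" if "u \<in> set p" "{u, x} \<in> edges T" for u x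
  proof (rule ccontr)
    assume x: "x \<notin> set p"
    obtain y where y: "y \<in> leaves T" "(x, y) \<in> connected_by (edges T - {{u, x}})"
      using leaf_beyond_edge[OF fin sub acyclic \<open>{u, x} \<in> edges T\<close>] by blast
    have "walk (edges T - {{u, x}}) p"
      using p(1) by (rule successively_mono) (use x in \<open>auto simp: doubleton_eq_iff\<close>)
    then have "(u, y) \<in> connected_by (edges T - {{u, x}})"
      using y(1) ab a b that(1) by (intro walk_connected_by) auto
    with y(2) have "(u, x) \<in> connected_by (edges T - {{u, x}})"
      by (blast intro: connected_by_sym connected_by_trans)
    moreover have "u \<noteq> x" using that(1) x by auto
    ultimately show False using bridge[OF acyclic that(2)] by blast
  qed
  have "set p \<subseteq> verts T"
  proof
    fix z assume "z \<in> set p"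
    with p a have "(a, z) \<in> connected_by (edges T)" by (intro walk_connected_by)
    then show "z \<in> verts T"
      by (induction rule: connected_by_induct) (use sub \<open>a \<in> verts T\<close> in auto)
  qed
  moreover have "verts T \<subseteq> set p"
  proof
    fix z assume "z \<in> verts T"
    with conn \<open>a \<in> verts T\<close> have "(a, z) \<in> connected_by (edges T)" by auto
    then show "z \<in> set p"
      by (induction rule: connected_by_induct) (use a closed in auto)
  qed
  ultimately have set: "set p = verts T" by blast
  \<comment> \<open>A chord would close the segment \<open>q\<close> of the walk between its ends to
    a cycle.\<close>
  have consec: "j = Suc i" if "i < j" "j < length p" "{p ! i, p ! j} \<in> edges T" for i j
  proof (rule ccontr)
    assume "j \<noteq> Suc i"
    define q where "q = take (Suc j - i) (drop i p)"
    have len: "length q = Suc j - i" unfolding q_def using that by simp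
    have nth: "q ! m = p ! (i + m)" if "m < length q" for m
      using that \<open>j < length p\<close> unfolding q_def by simp
    have "q \<noteq> []" using len that by auto
    have "walk (edges T) q"
      unfolding successively_conv_nth
      using p(1) len that by (auto simp: nth successively_conv_nth)
    moreover have "distinct q" unfolding q_def using p(2) by simp
    moreover have "3 \<le> length q" using len that \<open>j \<noteq> Suc i\<close> by simp
    moreover have "last q = p ! j" "hd q = p ! i"
      using len that nth[of 0] nth[of "j - i"] \<open>q \<noteq> []\<close>
      by (simp_all add: last_conv_nth hd_conv_nth)
    ultimately have "cycle (edges T) q"
      using that by (intro cycleI) (auto simp: insert_commute)
    with acyclic show False by blast
  qed
  have "edges T = {{p ! i, p ! Suc i} | i. Suc i < length p}"
  proof (intro equalityI subsetI)
    fix e assume e: "e \<in> edges T"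
    then obtain u v where uv: "e = {u, v}" "u \<noteq> v" using sub by (metis card_2_iff)
    with e sub have "u \<in> set p" "v \<in> set p" unfolding set by auto
    then obtain i j where ij: "i < length p" "p ! i = u" "j < length p" "p ! j = v"
      by (auto simp: in_set_conv_nth)
    with uv have "i < j \<or> j < i" by (cases i j rule: linorder_cases) auto
    then show "e \<in> {{p ! i, p ! Suc i} | i. Suc i < length p}"
    proof
      assume "i < j"
      with ij uv e consec[of i j] show ?thesis by blast
    next
      assume "j < i"
      with ij uv e consec[of j i] show ?thesis by (auto simp: insert_commute)
    qed
  next
    fix e assume "e \<in> {{p ! i, p ! Suc i} | i. Suc i < length p}"
    then show "e \<in> edges T" using p(1) by (auto simp: successively_conv_nth)
  qed
  moreover have "2 \<le> length p"
  proof (rule ccontr)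
    assume "\<not> 2 \<le> length p"
    then have "length p = 1" using p(3) by (cases p; cases "tl p") auto
    then have "hd p = last p" by (cases p) auto
    with p ab show False by simp
  qed
  ultimately show thesis
    using that p set unfolding path_list_def by blast
qed

section \<open>Coordinates on an oriented path\<close>

abbreviation nth_edge :: "nat list \<Rightarrow> nat \<Rightarrow> nat set" where
  "nth_edge p m \<equiv> {p ! m, p ! Suc m}"

lemma nth_edge_in_edges: "path_list T p \<Longrightarrow> Suc m < length p \<Longrightarrow> nth_edge p m \<in> edges T"
  unfolding path_list_def by blast

lemma path_list_edgeE:
  assumes "path_list T p" "e \<in> edges T"
  obtains m where "Suc m < length p" "e = nth_edge p m"
  using assms unfolding path_list_def by blast

lemma nth_edge_eq_iff:
  assumes "distinct p" "Suc i < length p" "Suc j < length p"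
  shows "nth_edge p i = nth_edge p j \<longleftrightarrow> i = j"
  using assms by (auto simp: doubleton_eq_iff nth_eq_iff_index_eq)

lemma inj_on_nth_edge: "distinct p \<Longrightarrow> inj_on (nth_edge p) {m. Suc m < length p}"
  by (simp add: inj_on_def nth_edge_eq_iff)

lemma edges_path_list: "path_list T p \<Longrightarrow> edges T = nth_edge p ` {m. Suc m < length p}"
  unfolding path_list_def by auto

text \<open>On a path there is no way around an edge: getting from position \<open>i\<close> to
  position \<open>j\<close> uses every edge in between.\<close>

lemma path_list_connected_by_iff:
  assumes p: "path_list T p" and F: "F \<subseteq> edges T" and ij: "i \<le> j" "j < length p"
  shows "(p ! i, p ! j) \<in> connected_by F \<longleftrightarrow> (\<forall>m. i \<le> m \<and> m < j \<longrightarrow> nth_edge p m \<in> F)"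
proof
  have d: "distinct p" using p unfolding path_list_def by blast
  \<comment> \<open>The walk may pass to either side of its starting position, so the induction
    hypothesis covers both orders of \<open>i\<close> and \<open>j\<close>.\<close>
  have "\<forall>j<length p. v = p ! j \<longrightarrow>
      (\<forall>m. i \<le> m \<and> m < j \<or> j \<le> m \<and> m < i \<longrightarrow> nth_edge p m \<in> F)"
    if "(p ! i, v) \<in> connected_by F" for v
    using that
  proof (induction rule: connected_by_induct)
    case refl
    show ?case using d ij by (auto simp: nth_eq_iff_index_eq)
  next
    case (step x y)
    then have "{x, y} \<in> edges T" using F by blast
    then obtain k where k: "Suc k < length p" "{x, y} = nth_edge p k"
      by (rule path_list_edgeE[OF p])
    then have kF: "nth_edge p k \<in> F" using step.hyps by simp
    from k(2) consider "x = p ! k" "y = p ! Suc k" | "x = p ! Suc k" "y = p ! k"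
      by (auto simp: doubleton_eq_iff)
    then show ?case
    proof cases
      case 1
      with step.IH k(1) have IH: "\<And>m. i \<le> m \<and> m < k \<or> k \<le> m \<and> m < i \<Longrightarrow> nth_edge p m \<in> F"
        by (metis Suc_lessD)
      show ?thesis
      proof (intro allI impI)
        fix j m assume j: "j < length p" "y = p ! j" and m: "i \<le> m \<and> m < j \<or> j \<le> m \<and> m < i"
        from j k(1) 1 d have "j = Suc k" by (simp add: nth_eq_iff_index_eq)
        with m have "m = k \<or> (i \<le> m \<and> m < k \<or> k \<le> m \<and> m < i)" by auto
        with IH kF show "nth_edge p m \<in> F" by blast
      qed
    next
      case 2
      with step.IH k(1) have IH: "\<And>m. i \<le> m \<and> m < Suc k \<or> Suc k \<le> m \<and> m < i \<Longrightarrow> nth_edge p m \<in> F"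
        by metis
      show ?thesis
      proof (intro allI impI)
        fix j m assume j: "j < length p" "y = p ! j" and m: "i \<le> m \<and> m < j \<or> j \<le> m \<and> m < i"
        from j k(1) 2 d have "j = k" by (simp add: nth_eq_iff_index_eq)
        with m have "m = k \<or> (i \<le> m \<and> m < Suc k \<or> Suc k \<le> m \<and> m < i)" by auto
        with IH kF show "nth_edge p m \<in> F" by blast
      qed
    qed
  qed
  then show "(p ! i, p ! j) \<in> connected_by F \<Longrightarrow> \<forall>m. i \<le> m \<and> m < j \<longrightarrow> nth_edge p m \<in> F"
    using ij by blast
next
  assume "\<forall>m. i \<le> m \<and> m < j \<longrightarrow> nth_edge p m \<in> F"
  with ij(1) show "(p ! i, p ! j) \<in> connected_by F"
  proof (induction j rule: dec_induct)
    case (step k)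
    then have "(p ! i, p ! k) \<in> connected_by F" "nth_edge p k \<in> F" by auto
    then show ?case by (blast intro: connected_by_edge connected_by_trans)
  qed simp
qed

lemma path_list_valence:
  assumes p: "path_list T p" and j: "j < length p"
  shows "valence T (p ! j) = (if j = 0 \<or> Suc j = length p then 1 else 2)"
proof -
  have d: "distinct p" "2 \<le> length p" using p unfolding path_list_def by auto
  let ?M = "{m. Suc m < length p \<and> (m = j \<or> Suc m = j)}"
  have "{e \<in> edges T. p ! j \<in> e} = nth_edge p ` ?M"
    using j d by (auto simp: edges_path_list[OF p] nth_eq_iff_index_eq)
  moreover have "inj_on (nth_edge p) ?M"
    using inj_on_nth_edge[OF d(1)] by (rule inj_on_subset) auto
  ultimately have "valence T (p ! j) = card ?M"
    unfolding valence_def by (simp add: card_image)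
  also have "?M = (if Suc j < length p then {j} else {}) \<union> (if j = 0 then {} else {j - 1})"
    using j by auto
  also have "card \<dots> = (if j = 0 \<or> Suc j = length p then 1 else 2)"
    using j d(2) by (cases j) auto
  finally show ?thesis .
qed

lemma leaves_path_list:
  assumes p: "path_list T p"
  shows "leaves T = {hd p, last p}"
proof -
  have d: "distinct p" "2 \<le> length p" "set p = verts T" using p unfolding path_list_def by auto
  then have "p \<noteq> []" by auto
  then have hl: "hd p = p ! 0" "last p = p ! (length p - 1)" "p \<noteq> []"
    by (simp_all add: hd_conv_nth last_conv_nth)
  have "v \<in> leaves T \<longleftrightarrow> v = hd p \<or> v = last p" for v
  proof -
    have "v \<in> leaves T \<longleftrightarrow> (\<exists>j<length p. v = p ! j \<and> valence T (p ! j) = 1)"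
      unfolding leaves_def d(3)[symmetric] by (auto simp: in_set_conv_nth)
    also have "\<dots> \<longleftrightarrow> (\<exists>j<length p. v = p ! j \<and> (j = 0 \<or> Suc j = length p))"
      by (intro ex_cong1 conj_cong refl) (auto simp: path_list_valence[OF p])
    also have "\<dots> \<longleftrightarrow> v = hd p \<or> v = last p"
    proof
      assume "\<exists>j<length p. v = p ! j \<and> (j = 0 \<or> Suc j = length p)"
      then show "v = hd p \<or> v = last p" unfolding hl(1,2) by (metis diff_Suc_1)
    next
      assume "v = hd p \<or> v = last p"
      then show "\<exists>j<length p. v = p ! j \<and> (j = 0 \<or> Suc j = length p)"
        unfolding hl(1,2)
      proof
        assume "v = p ! 0"
        with hl(3) show ?thesis by (intro exI[of _ 0]) simp
      next
        assume "v = p ! (length p - 1)"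
        with hl(3) show ?thesis by (intro exI[of _ "length p - 1"]) simp
      qed
    qed
    finally show ?thesis .
  qed
  then show ?thesis by blast
qed

text \<open>Connectivity rather than a position on a vertex list defines the left part, so it can be
  followed through contractions, which are given by vertex maps.\<close>

definition side :: "nat \<Rightarrow> otree \<Rightarrow> nat set \<Rightarrow> nat set" where
  "side n X e = {i \<in> {1..n}.
     (snd X LabelL, mark (fst X) i) \<in> connected_by (edges (fst X) - {e})}"

section \<open>Positions of the marks and the chain of left parts\<close>

locale oriented_path =
  fixes n :: nat and w :: "nat \<Rightarrow> real" and T :: mtree and r :: "label \<Rightarrow> nat" and p :: "nat list"
  assumes weight_pos: "\<forall>i\<in>{1..n}. 0 < w i"
    and stable: "T \<in> stable_trees n w"
    and path: "path_list T p"
    and left: "r LabelL = hd p" and right: "r LabelR = last p"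
begin

lemma dist: "distinct p" and len: "2 \<le> length p" and verts: "set p = verts T"
  using path unfolding path_list_def by auto

lemma left_nth: "r LabelL = p ! 0" and right_nth: "r LabelR = p ! (length p - 1)"
proof -
  have "p \<noteq> []" using len by auto
  then show "r LabelL = p ! 0" and "r LabelR = p ! (length p - 1)"
    using left right by (simp_all add: hd_conv_nth last_conv_nth)
qed

definition pos :: "nat \<Rightarrow> nat" where
  "pos i = (SOME j. j < length p \<and> p ! j = mark T i)"

lemma pos:
  assumes "i \<in> {1..n}"
  shows "pos i < length p" and "p ! pos i = mark T i"
proof -
  have "mark T i \<in> set p"
    using stable assms verts unfolding stable_trees_def marked_tree_def by blast
  then have "\<exists>j. j < length p \<and> p ! j = mark T i" by (simp add: in_set_conv_nth)
  then have "pos i < length p \<and> p ! pos i = mark T i"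
    unfolding pos_def by (rule someI_ex)
  then show "pos i < length p" and "p ! pos i = mark T i" by auto
qed

lemma marks_at: "j < length p \<Longrightarrow> {i \<in> {1..n}. mark T i = p ! j} = {i \<in> {1..n}. pos i = j}"
proof -
  assume j: "j < length p"
  have "mark T i = p ! j \<longleftrightarrow> pos i = j" if "i \<in> {1..n}" for i
    using nth_eq_iff_index_eq[OF dist pos(1)[OF that] j] pos(2)[OF that] by simp
  then show ?thesis by blast
qed

lemma stable_at:
  assumes "j < length p"
  shows "real (valence T (p ! j)) + sum w {i \<in> {1..n}. pos i = j} > 2"
proof -
  have "p ! j \<in> verts T" using nth_mem[OF assms] by (simp only: verts)
  then have "real (valence T (p ! j)) + sum w {i \<in> {1..n}. mark T i = p ! j} > 2"
    using stable unfolding stable_trees_def by blast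
  then show ?thesis by (simp only: marks_at[OF assms])
qed

text \<open>A vertex of a path has at most two edges, and stability demands strictly more than
  2.\<close>

lemma mark_exists:
  assumes "j < length p"
  shows "\<exists>i\<in>{1..n}. pos i = j"
proof (rule ccontr)
  assume "\<not> ?thesis"
  then have "sum w {i \<in> {1..n}. pos i = j} = 0" by (intro sum.neutral) blast
  then have "real (valence T (p ! j)) > 2" using stable_at[OF assms] by linarith
  then show False
    using path_list_valence[OF path assms] by (simp split: if_splits)
qed

text \<open>The single edge at a leaf contributes 1 to the stability bound 2, so its marks must
  supply more than 1. This is where the threshold 1 for heavy subsets comes from.\<close>

lemma end_weights:
  "sum w {i \<in> {1..n}. pos i = 0} > 1" "sum w {i \<in> {1..n}. pos i = length p - 1} > 1"
proof -
  have *: "sum w {i \<in> {1..n}. pos i = j} > 1" if "j = 0 \<or> Suc j = length p" for j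
  proof -
    have j: "j < length p" using that len by auto
    have "real (valence T (p ! j)) = 1" using path_list_valence[OF path j] that by simp
    then show ?thesis using stable_at[OF j] by linarith
  qed
  show "sum w {i \<in> {1..n}. pos i = 0} > 1" by (rule *) simp
  show "sum w {i \<in> {1..n}. pos i = length p - 1} > 1" by (rule *) (use len in simp)
qed

lemma connected_to_left:
  assumes "Suc m < length p" "j < length p"
  shows "(r LabelL, p ! j) \<in> connected_by (edges T - {nth_edge p m}) \<longleftrightarrow> j \<le> m"
proof -
  have "nth_edge p k \<in> edges T - {nth_edge p m} \<longleftrightarrow> k \<noteq> m" if "k < j" for k
    using that assms nth_edge_eq_iff[OF dist] nth_edge_in_edges[OF path] by auto
  with assms show ?thesis
    unfolding left_nth
    by (subst path_list_connected_by_iff[OF path]) (auto simp: not_less[symmetric])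
qed

lemma connected_to_right:
  assumes "Suc m < length p" "j < length p"
  shows "(r LabelR, p ! j) \<in> connected_by (edges T - {nth_edge p m}) \<longleftrightarrow> m < j"
proof -
  have "nth_edge p k \<in> edges T - {nth_edge p m} \<longleftrightarrow> k \<noteq> m" if "k < length p - 1" for k
    using that assms nth_edge_eq_iff[OF dist] nth_edge_in_edges[OF path] by auto
  then have "(\<forall>k. j \<le> k \<and> k < length p - 1 \<longrightarrow> nth_edge p k \<in> edges T - {nth_edge p m}) \<longleftrightarrow> m < j"
    using assms by (auto simp: not_less[symmetric])
  moreover have "(p ! j, p ! (length p - 1)) \<in> connected_by (edges T - {nth_edge p m}) \<longleftrightarrow>
      (\<forall>k. j \<le> k \<and> k < length p - 1 \<longrightarrow> nth_edge p k \<in> edges T - {nth_edge p m})"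
    using assms by (intro path_list_connected_by_iff[OF path]) auto
  ultimately show ?thesis
    unfolding right_nth by (blast intro: connected_by_sym)
qed

lemma side_nth_edge:
  assumes "Suc m < length p"
  shows "side n (T, r) (nth_edge p m) = {i \<in> {1..n}. pos i \<le> m}"
  unfolding side_def fst_conv snd_conv
  using connected_to_left[OF assms pos(1)] pos(2) by (metis (lifting))

text \<open>Only the leaf labelled L enters \<open>side\<close>; with that label at the other end,
  \<open>side\<close> picks out the other component left by the removed edge.\<close>

lemma side_reversed:
  assumes "e \<in> edges T" "r' LabelL = r LabelR"
  shows "side n (T, r') e = {1..n} - side n (T, r) e"
proof -
  obtain m where m: "Suc m < length p" "e = nth_edge p m"
    using path assms(1) by (rule path_list_edgeE)
  have "side n (T, r') e = {i \<in> {1..n}. m < pos i}"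
    unfolding side_def fst_conv snd_conv m(2) assms(2)
    using connected_to_right[OF m(1) pos(1)] pos(2) by (metis (lifting))
  also have "\<dots> = {1..n} - {i \<in> {1..n}. pos i \<le> m}" by (auto simp: not_le)
  also have "\<dots> = {1..n} - side n (T, r) e" by (simp only: side_nth_edge[OF m(1)] m(2))
  finally show ?thesis .
qed

lemma side_strict_mono:
  assumes "k < m" "Suc m < length p"
  shows "side n (T, r) (nth_edge p k) \<subset> side n (T, r) (nth_edge p m)"
proof -
  \<comment> \<open>A mark at the vertex in position \<open>m\<close> lies to the left of the edge
    \<open>m\<close> but to the right of every earlier edge, so it witnesses strictness.\<close>
  obtain i where "i \<in> {1..n}" "pos i = m" using mark_exists[of m] assms by (meson Suc_lessD)
  then have "i \<in> {i \<in> {1..n}. pos i \<le> m} - {i \<in> {1..n}. pos i \<le> k}" using assms by simp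
  moreover have "{i \<in> {1..n}. pos i \<le> k} \<subseteq> {i \<in> {1..n}. pos i \<le> m}" using assms by auto
  ultimately have "{i \<in> {1..n}. pos i \<le> k} \<subset> {i \<in> {1..n}. pos i \<le> m}" by blast
  moreover have "Suc k < length p" using assms by simp
  ultimately show ?thesis using assms(2) by (simp only: side_nth_edge)
qed

text \<open>The left part contains all marks of the first vertex, its complement all marks of the
  last one, and both ends are heavy.\<close>

lemma side_heavy:
  assumes "e \<in> edges T"
  shows "side n (T, r) e \<in> heavy_subsets n w"
proof -
  obtain m where m: "Suc m < length p" "e = nth_edge p m"
    using path assms by (rule path_list_edgeE)
  have "sum w {i \<in> {1..n}. pos i = 0} \<le> sum w {i \<in> {1..n}. pos i \<le> m}"
    using weight_pos by (intro sum_mono2) (auto intro: less_imp_le)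
  moreover have "sum w {i \<in> {1..n}. pos i = length p - 1} \<le> sum w ({1..n} - {i \<in> {1..n}. pos i \<le> m})"
    using weight_pos m by (intro sum_mono2) (auto intro: less_imp_le)
  ultimately show ?thesis
    using end_weights m unfolding heavy_subsets_def by (auto simp: side_nth_edge)
qed

lemma inj_on_side: "inj_on (side n (T, r)) (edges T)"
proof (rule inj_onI)
  fix e e' assume "e \<in> edges T" "e' \<in> edges T" and eq: "side n (T, r) e = side n (T, r) e'"
  then obtain m m' where m: "Suc m < length p" "e = nth_edge p m"
      and m': "Suc m' < length p" "e' = nth_edge p m'"
    using path by (meson path_list_edgeE)
  show "e = e'"
    using side_strict_mono[of m m'] side_strict_mono[of m' m] m m' eq
    by (cases m m' rule: linorder_cases) auto
qed

lemma side_image: "side n (T, r) ` edges T \<in> order_complex (heavy_subsets n w)"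
proof -
  let ?s = "\<lambda>m. side n (T, r) (nth_edge p m)"
  have "?s m \<subseteq> ?s m' \<or> ?s m' \<subseteq> ?s m" if "Suc m < length p" "Suc m' < length p" for m m'
    using side_strict_mono[of m m'] side_strict_mono[of m' m] that
    by (cases m m' rule: linorder_cases) auto
  then have "side n (T, r) ` edges T \<in> chains (heavy_subsets n w)"
    unfolding chains_def chain_subset_def using side_heavy
    by (auto simp: edges_path_list[OF path])
  moreover have "0 \<in> {m. Suc m < length p}" using len by simp
  moreover have "finite {m. Suc m < length p}"
    by (rule finite_subset[of _ "{..<length p}"]) auto
  ultimately show ?thesis
    unfolding order_complex_def edges_path_list[OF path] by blast
qed

end

lemma oriented_path_exists:
  assumes "\<forall>i\<in>{1..n}. 0 < w i" and "(T, r) \<in> oriented_paths n w"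
  obtains p where "oriented_path n w T r p"
proof -
  have "range r = {r LabelL, r LabelR}"
    by (auto simp: image_iff) (metis label.exhaust)
  with assms(2) have "T \<in> stable_trees n w" "leaves T = {r LabelL, r LabelR}"
      "r LabelL \<noteq> r LabelR"
    unfolding oriented_paths_def by (auto dest: injD)
  moreover from this obtain p where "path_list T p" "hd p = r LabelL" "last p = r LabelR"
    unfolding stable_trees_def by (blast elim: path_list_exists)
  ultimately show thesis
    using that assms(1) unfolding oriented_path_def by metis
qed

lemma (in oriented_path) oriented: "(T, r) \<in> oriented_paths n w"
proof -
  have "range r = {r LabelL, r LabelR}"
    by (auto simp: image_iff) (metis label.exhaust)
  then have "range r = leaves T"
    using leaves_path_list[OF path] left right by simp
  moreover have "r LabelL \<noteq> r LabelR"
    unfolding left_nth right_nth using len dist by (subst nth_eq_iff_index_eq) auto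
  then have "inj r"
    unfolding inj_def by (metis (full_types) label.exhaust)
  ultimately show ?thesis using stable unfolding oriented_paths_def by blast
qed

section \<open>Contractions\<close>

lemma contraction_subset: "contraction n T F T' c \<Longrightarrow> F \<subseteq> edges T"
  and contraction_verts: "contraction n T F T' c \<Longrightarrow> c ` verts T = verts T'"
  and contraction_edges: "contraction n T F T' c \<Longrightarrow> edges T' = (\<lambda>e. c ` e) ` (edges T - F)"
  and contraction_mark: "contraction n T F T' c \<Longrightarrow> i \<in> {1..n} \<Longrightarrow> mark T' i = c (mark T i)"
  by (simp_all add: contraction_def)

lemma contraction_eq_iff:
  assumes "contraction n T F T' c" "u \<in> verts T" "v \<in> verts T"
  shows "c u = c v \<longleftrightarrow> (u, v) \<in> connected_by F"
  using assms by (simp add: contraction_def)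

lemma contracted_edge:
  assumes "contraction n T F T' c" "e \<in> edges T - F"
  shows "c ` e \<in> edges T'"
  using assms by (simp add: contraction_edges)

text \<open>If two surviving edges had the same image, their corresponding ends would be joined
  inside \<open>F\<close>. These connections and the second edge would form a detour around the
  first, against \<open>bridge\<close>.\<close>

lemma contraction_inj_on_edges:
  assumes T: "marked_tree n T" and con: "contraction n T F T' c"
  shows "inj_on (image c) (edges T - F)"
proof (rule inj_onI)
  have sub: "\<forall>e\<in>edges T. e \<subseteq> verts T \<and> card e = 2" and acyclic: "\<nexists>p. cycle (edges T) p"
    using T unfolding marked_tree_def by auto
  \<comment> \<open>The claim fixes which ends correspond; the opposite matching follows by
    exchanging \<open>a'\<close> and \<open>b'\<close>.\<close>
  have *: "{a, b} = {a', b'}"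
    if e: "{a, b} \<in> edges T - F" "{a', b'} \<in> edges T - F" and eq: "c a = c a'" "c b = c b'"
    for a b a' b'
  proof (rule ccontr)
    assume neq: "{a, b} \<noteq> {a', b'}"
    have v: "a \<in> verts T" "b \<in> verts T" "a' \<in> verts T" "b' \<in> verts T" and "a \<noteq> b"
      using bspec[OF sub, of "{a, b}"] bspec[OF sub, of "{a', b'}"] e
      by (auto simp: card_insert_if split: if_splits)
    let ?E = "edges T - {{a, b}}"
    have "F \<subseteq> ?E" using contraction_subset[OF con] e by blast
    then have "(a, a') \<in> connected_by ?E" "(b', b) \<in> connected_by ?E"
      using eq v contraction_eq_iff[OF con] by (metis connected_by_mono)+
    moreover have "(a', b') \<in> connected_by ?E"
      using e neq by (intro connected_by_edge) blast
    ultimately have "(a, b) \<in> connected_by ?E" by (metis connected_by_trans)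
    then show False using bridge[OF acyclic, of a b] e \<open>a \<noteq> b\<close> by blast
  qed
  fix e e' assume e: "e \<in> edges T - F" "e' \<in> edges T - F" and eq: "c ` e = c ` e'"
  then have "card e = 2" "card e' = 2" using sub by auto
  then obtain a b a' b' where ab: "e = {a, b}" "e' = {a', b'}" by (meson card_2_iff)
  then have "c a = c a' \<and> c b = c b' \<or> c a = c b' \<and> c b = c a'"
    using eq by (auto simp: doubleton_eq_iff)
  then show "e = e'"
  proof
    assume "c a = c a' \<and> c b = c b'"
    then show ?thesis using *[of a b a' b'] e unfolding ab by blast
  next
    assume "c a = c b' \<and> c b = c a'"
    then show ?thesis using *[of a b b' a'] e unfolding ab by (simp add: insert_commute)
  qed
qed

text \<open>Deleting an edge commutes with contracting others: \<open>F\<close> does not contain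
  \<open>e\<close>, so the fibres of \<open>c\<close> stay connected after \<open>e\<close> is
  deleted, and by injectivity on edges no other edge is mapped onto the image of
  \<open>e\<close>.\<close>

lemma contraction_connected_iff:
  assumes T: "marked_tree n T" and con: "contraction n T F T' c" and e: "e \<in> edges T - F"
    and u: "u \<in> verts T" and v: "v \<in> verts T"
  shows "(c u, c v) \<in> connected_by (edges T' - {c ` e}) \<longleftrightarrow> (u, v) \<in> connected_by (edges T - {e})"
proof
  have sub: "\<forall>e\<in>edges T. e \<subseteq> verts T" using T unfolding marked_tree_def by auto
  have F: "F \<subseteq> edges T - {e}" using contraction_subset[OF con] e by blast
  note edges' = contraction_edges[OF con]
  { assume "(u, v) \<in> connected_by (edges T - {e})"
    then show "(c u, c v) \<in> connected_by (edges T' - {c ` e})"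
    proof (induction rule: connected_by_induct)
      case (step x y)
      have "(c x, c y) \<in> connected_by (edges T' - {c ` e})"
      proof (cases "{x, y} \<in> F")
        case True
        then have "c x = c y"
          using step.hyps sub by (subst contraction_eq_iff[OF con]) (auto intro: connected_by_edge)
        then show ?thesis by simp
      next
        case False
        then have "{x, y} \<in> edges T - F" "{x, y} \<noteq> e" using step.hyps by auto
        then have "c ` {x, y} \<in> edges T'" "c ` {x, y} \<noteq> c ` e"
          using e contracted_edge[OF con] contraction_inj_on_edges[OF T con]
          by (blast, metis inj_on_eq_iff)
        then show ?thesis by (intro connected_by_edge) simp
      qed
      with step.IH show ?case by (rule connected_by_trans)
    qed simp }
  \<comment> \<open>Lifts of consecutive edges need not share a vertex; their ends only lie in the
    same fibre. Quantifying over all preimages of \<open>y\<close> lets \<open>F\<close> fill these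
    gaps.\<close>
  have "\<forall>v\<in>verts T. c v = y \<longrightarrow> (u, v) \<in> connected_by (edges T - {e})"
    if "(c u, y) \<in> connected_by (edges T' - {c ` e})" for y
    using that
  proof (induction rule: connected_by_induct)
    case refl
    then show ?case
      using u contraction_eq_iff[OF con] F by (metis connected_by_mono)
  next
    case (step x y)
    show ?case
    proof (intro ballI impI)
      fix v assume v: "v \<in> verts T" "c v = y"
      obtain e0 where e0: "e0 \<in> edges T - F" "c ` e0 = {x, y}" "e0 \<noteq> e"
        using step.hyps unfolding edges' by blast
      have "x \<in> c ` e0" "y \<in> c ` e0" using e0 by auto
      then obtain a b where ab: "a \<in> e0" "c a = x" "b \<in> e0" "c b = y" by blast
      have abv: "a \<in> verts T" "b \<in> verts T" using ab e0 sub by auto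
      have "(a, b) \<in> connected_by (edges T - {e})"
      proof (cases "a = b")
        case False
        have "card e0 = 2" using e0 T unfolding marked_tree_def by auto
        with ab False have "e0 = {a, b}" by (auto simp: card_2_iff)
        then show ?thesis using e0 by (intro connected_by_edge) auto
      qed simp
      moreover have "(u, a) \<in> connected_by (edges T - {e})"
        using step.IH ab abv by blast
      moreover have "(b, v) \<in> connected_by (edges T - {e})"
        using v ab abv contraction_eq_iff[OF con] F by (metis connected_by_mono)
      ultimately show "(u, v) \<in> connected_by (edges T - {e})"
        by (metis connected_by_trans)
    qed
  qed
  then show "(c u, c v) \<in> connected_by (edges T' - {c ` e}) \<Longrightarrow> (u, v) \<in> connected_by (edges T - {e})"
    using v by blast
qed

lemma side_contraction:
  assumes T: "marked_tree n T" and con: "contraction n T F T' c" and e: "e \<in> edges T - F"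
    and r: "r LabelL \<in> verts T" "r' LabelL = c (r LabelL)"
  shows "side n (T', r') (c ` e) = side n (T, r) e"
proof -
  have "(r' LabelL, mark T' i) \<in> connected_by (edges T' - {c ` e})
      \<longleftrightarrow> (r LabelL, mark T i) \<in> connected_by (edges T - {e})" if "i \<in> {1..n}" for i
  proof -
    have "mark T i \<in> verts T" using T that unfolding marked_tree_def by blast
    moreover have "mark T' i = c (mark T i)" using contraction_mark[OF con that] .
    ultimately show ?thesis
      using contraction_connected_iff[OF T con e r(1)] r(2) by simp
  qed
  then show ?thesis unfolding side_def by auto
qed

text \<open>A vertex of \<open>T'\<close> that is not the image of an end of the path meets the images of two
  uncontracted edges, one on each side of its fibre.\<close>

lemma leaves_contraction_subset:
  assumes T: "marked_tree n T" and p: "path_list T p" and con: "contraction n T F T' c"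
  shows "leaves T' \<subseteq> {c (hd p), c (last p)}"
proof
  fix x assume x: "x \<in> leaves T'"
  have d: "distinct p" "2 \<le> length p" "set p = verts T" using p unfolding path_list_def by auto
  then have "p \<noteq> []" by auto
  then have hl: "hd p = p ! 0" "last p = p ! (length p - 1)"
    by (simp_all add: hd_conv_nth last_conv_nth)
  note F = contraction_subset[OF con] and c = contraction_verts[OF con]
  from x c d(3) have "x \<in> c ` set p" unfolding leaves_def by simp
  then obtain j where j: "j < length p" "x = c (p ! j)" by (auto simp: in_set_conv_nth)
  have c_eq: "c (p ! i) = c (p ! k) \<longleftrightarrow> (\<forall>m. i \<le> m \<and> m < k \<longrightarrow> nth_edge p m \<in> F)"
    if "i \<le> k" "k < length p" for i k
    using that d(3) nth_mem[of i p] nth_mem[of k p] path_list_connected_by_iff[OF p F that]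
    by (subst contraction_eq_iff[OF con]) auto
  show "x \<in> {c (hd p), c (last p)}"
  proof (rule ccontr)
    assume x': "x \<notin> {c (hd p), c (last p)}"
    \<comment> \<open>Since \<open>x\<close> is not the image of an end, surviving edges exist on
      both sides of position \<open>j\<close>. The nearest ones, \<open>m\<close> and
      \<open>m'\<close>, bound the fibre of \<open>x\<close>, and their distinct images both meet
      \<open>x\<close>, which contradicts valence 1.\<close>
    let ?P = "\<lambda>m. m < j \<and> nth_edge p m \<notin> F"
    have "\<exists>m. ?P m"
      using x' j c_eq[of 0 j] unfolding hl by auto
    then obtain m0 where "?P m0" ..
    then have "\<exists>m. ?P m \<and> (\<forall>k. ?P k \<longrightarrow> k \<le> m)"
      by (rule ex_has_greatest_nat[of ?P m0 "\<lambda>x. x" j]) simp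
    then obtain m where m: "m < j" "nth_edge p m \<notin> F" "\<And>k. k < j \<Longrightarrow> nth_edge p k \<notin> F \<Longrightarrow> k \<le> m"
      by blast
    let ?Q = "\<lambda>m. j \<le> m \<and> m < length p - 1 \<and> nth_edge p m \<notin> F"
    define m' where "m' = (LEAST m. ?Q m)"
    have "\<exists>m. ?Q m"
      using x' j c_eq[of j "length p - 1"] unfolding hl by auto
    then have "?Q m'" unfolding m'_def by (rule LeastI_ex)
    moreover have "\<not> ?Q k" if "k < m'" for k using that unfolding m'_def by (rule not_less_Least)
    ultimately have m': "j \<le> m'" "m' < length p - 1" "nth_edge p m' \<notin> F"
        "\<And>k. j \<le> k \<Longrightarrow> k < m' \<Longrightarrow> nth_edge p k \<in> F"
      using less_trans by blast+
    have lens: "Suc m < length p" "Suc m' < length p" using m m' j by auto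
    have "c (p ! Suc m) = x"
    proof -
      have "\<forall>k. Suc m \<le> k \<and> k < j \<longrightarrow> nth_edge p k \<in> F" using m(3) not_less_eq_eq by blast
      then show ?thesis using c_eq[of "Suc m" j] m(1) j by simp
    qed
    moreover have "c (p ! m') = x"
      using c_eq[of j m'] m' j by auto
    moreover have E: "nth_edge p m \<in> edges T - F" "nth_edge p m' \<in> edges T - F"
      using nth_edge_in_edges[OF p] lens m m' by auto
    ultimately have two: "{c ` nth_edge p m, c ` nth_edge p m'} \<subseteq> {e \<in> edges T'. x \<in> e}"
      using contracted_edge[OF con E(1)] contracted_edge[OF con E(2)] by auto
    have neq: "c ` nth_edge p m \<noteq> c ` nth_edge p m'"
      using inj_onD[OF contraction_inj_on_edges[OF T con] _ E] nth_edge_eq_iff[OF d(1) lens] m m'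
      by auto
    have "card {e \<in> edges T'. x \<in> e} = 1"
      using x unfolding leaves_def valence_def by simp
    then obtain e where "{e \<in> edges T'. x \<in> e} = {e}" by (rule card_1_singletonE)
    with two have "c ` nth_edge p m = e" "c ` nth_edge p m' = e"
      by (simp_all only: insert_subset singleton_iff)
    with neq show False by metis
  qed
qed

section \<open>Orientations\<close>

definition opposite :: "label \<Rightarrow> label" where
  "opposite x = (case x of LabelL \<Rightarrow> LabelR | LabelR \<Rightarrow> LabelL)"

lemma opposite_simps [simp]:
  "opposite LabelL = LabelR" "opposite LabelR = LabelL" "opposite (opposite x) = x"
  by (cases x; simp add: opposite_def)+

lemma UNIV_label: "UNIV = {LabelL, LabelR}"
proof -
  have "x \<in> {LabelL, LabelR}" for x by (cases x) auto
  then show ?thesis by blast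
qed

lemma label_fun_eq_iff: "r = r' \<longleftrightarrow> r LabelL = r' LabelL \<and> r LabelR = r' LabelR"
  for r r' :: "label \<Rightarrow> nat"
proof
  assume *: "r LabelL = r' LabelL \<and> r LabelR = r' LabelR"
  show "r = r'"
  proof
    fix x show "r x = r' x" using * by (cases x) auto
  qed
qed simp

lemma oriented_paths_iff:
  "(T, r) \<in> oriented_paths n w \<longleftrightarrow>
     T \<in> stable_trees n w \<and> r LabelL \<noteq> r LabelR \<and> leaves T = {r LabelL, r LabelR}"
proof -
  have "range r = {r LabelL, r LabelR}" unfolding UNIV_label by simp
  moreover have "inj r \<longleftrightarrow> r LabelL \<noteq> r LabelR" unfolding UNIV_label by (auto simp: inj_on_def)
  ultimately show ?thesis unfolding oriented_paths_def by auto
qed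

lemma opposite_oriented: "(T, r) \<in> oriented_paths n w \<Longrightarrow> (T, r \<circ> opposite) \<in> oriented_paths n w"
  unfolding oriented_paths_iff by (simp add: insert_commute)

lemma orientation_cases:
  assumes "(T, r) \<in> oriented_paths n w" "(T, r') \<in> oriented_paths n w"
  shows "r' = r \<or> r' = r \<circ> opposite"
proof -
  have "{r' LabelL, r' LabelR} = {r LabelL, r LabelR}"
    using assms by (simp add: oriented_paths_iff)
  then show ?thesis unfolding label_fun_eq_iff by (simp add: doubleton_eq_iff)
qed

lemma orientation_exists:
  assumes "path_space n w" "T \<in> stable_trees n w" "edges T \<noteq> {}"
  obtains r where "(T, r) \<in> oriented_paths n w"
proof -
  have "card (leaves T) = 2" using assms unfolding path_space_def by blast
  then obtain a b where "leaves T = {a, b}" "a \<noteq> b" by (meson card_2_iff)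
  then have "(T, case_label a b) \<in> oriented_paths n w"
    using assms by (simp add: oriented_paths_iff)
  with that show thesis .
qed

lemma oriented_edges_nonempty:
  assumes "(T, r) \<in> oriented_paths n w"
  shows "edges T \<noteq> {}"
proof -
  have "valence T (r LabelL) = 1"
    using assms unfolding oriented_paths_iff leaves_def by blast
  then show ?thesis unfolding valence_def by auto
qed

text \<open>The images of the two ends are the only candidates for leaves of \<open>T'\<close>. In a
  path space \<open>T'\<close> has two leaves, so both candidates are leaves and they are
  distinct.\<close>

lemma push_orientation:
  assumes w: "\<forall>i\<in>{1..n}. 0 < w i" and ps: "path_space n w"
    and T: "(T, r) \<in> oriented_paths n w" and T': "T' \<in> stable_trees n w" "edges T' \<noteq> {}"
    and con: "contraction n T F T' c"
  shows "(T', c \<circ> r) \<in> oriented_paths n w"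
proof -
  obtain p where "oriented_path n w T r p" using oriented_path_exists[OF w T] .
  then interpret oriented_path n w T r p .
  have "marked_tree n T" using stable unfolding stable_trees_def by blast
  then have sub: "leaves T' \<subseteq> {c (r LabelL), c (r LabelR)}"
    using leaves_contraction_subset[OF _ path con] left right by simp
  have "card (leaves T') = 2" using ps T' unfolding path_space_def by blast
  then obtain a b where "leaves T' = {a, b}" "a \<noteq> b" by (meson card_2_iff)
  with sub have "leaves T' = {c (r LabelL), c (r LabelR)} \<and> c (r LabelL) \<noteq> c (r LabelR)" by auto
  with T' show ?thesis by (simp add: oriented_paths_iff)
qed

text \<open>Choose any orientation of \<open>T\<close> and push it forward. The result is
  \<open>r'\<close> or its reverse; in the second case reverse the choice.\<close>

lemma pull_orientation:
  assumes w: "\<forall>i\<in>{1..n}. 0 < w i" and ps: "path_space n w"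
    and T': "(T', r') \<in> oriented_paths n w" and T: "T \<in> stable_trees n w"
    and con: "contraction n T F T' c"
  obtains r where "(T, r) \<in> oriented_paths n w" "r' = c \<circ> r"
proof -
  have "edges T' \<noteq> {}" using oriented_edges_nonempty[OF T'] .
  then have "edges T \<noteq> {}" using contraction_edges[OF con] by auto
  then obtain r where r: "(T, r) \<in> oriented_paths n w"
    using orientation_exists[OF ps T] by blast
  have "T' \<in> stable_trees n w" using T' by (simp add: oriented_paths_iff)
  then have "(T', c \<circ> r) \<in> oriented_paths n w"
    using push_orientation[OF w ps r _ \<open>edges T' \<noteq> {}\<close> con] by blast
  then have "r' = c \<circ> r \<or> r' = c \<circ> (r \<circ> opposite)"
    using orientation_cases[OF _ T', of "c \<circ> r"] by (auto simp: comp_assoc)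
  then show thesis using that r opposite_oriented[OF r] by blast
qed

section \<open>The path of a chain\<close>

text \<open>No enumeration of the chain is chosen: the members missing \<open>i\<close> are the
  smallest ones, so their number is the index of the first member containing \<open>i\<close>, or
  the last vertex if no member does.\<close>

definition chain_tree :: "nat set set \<Rightarrow> mtree" where
  "chain_tree \<sigma> = \<lparr>verts = {..card \<sigma>}, edges = (\<lambda>j. {j, Suc j}) ` {..<card \<sigma>},
     mark = (\<lambda>i. card {A \<in> \<sigma>. i \<notin> A})\<rparr>"

definition chain_path :: "nat set set \<Rightarrow> otree" where
  "chain_path \<sigma> = (chain_tree \<sigma>, case_label 0 (card \<sigma>))"

lemma chain_tree_simps:
  "verts (chain_tree \<sigma>) = {..card \<sigma>}"
  "edges (chain_tree \<sigma>) = (\<lambda>j. {j, Suc j}) ` {..<card \<sigma>}"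
  "mark (chain_tree \<sigma>) i = card {A \<in> \<sigma>. i \<notin> A}"
  unfolding chain_tree_def by simp_all

text \<open>In a chain a maximal member contains all others, so it can be put last, after the
  enumeration of the rest.\<close>

lemma finite_chain_enum:
  fixes \<sigma> :: "'a set set"
  assumes "finite \<sigma>" and "chain\<^sub>\<subseteq> \<sigma>"
  obtains A where "\<sigma> = A ` {..<card \<sigma>}" "\<And>i j. i < j \<Longrightarrow> j < card \<sigma> \<Longrightarrow> A i \<subset> A j"
proof -
  have "\<exists>A. \<sigma> = A ` {..<card \<sigma>} \<and> (\<forall>i j. i < j \<longrightarrow> j < card \<sigma> \<longrightarrow> A i \<subset> A j)"
    using assms
  proof (induction "card \<sigma>" arbitrary: \<sigma>)
    case (Suc k)
    then have "\<sigma> \<noteq> {}" by auto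
    then obtain M where M: "M \<in> \<sigma>" "\<And>B. B \<in> \<sigma> \<Longrightarrow> M \<subseteq> B \<Longrightarrow> M = B"
      using finite_has_maximal[OF \<open>finite \<sigma>\<close>] by metis
    have sub: "B \<subset> M" if "B \<in> \<sigma> - {M}" for B
      using that M Suc.prems(2) unfolding chain_subset_def by blast
    have k: "k = card (\<sigma> - {M})" using Suc.hyps(2) M(1) Suc.prems(1) by simp
    moreover have "finite (\<sigma> - {M})" "chain\<^sub>\<subseteq> (\<sigma> - {M})"
      using Suc.prems unfolding chain_subset_def by auto
    ultimately obtain A where A: "\<sigma> - {M} = A ` {..<k}" "\<forall>i j. i < j \<longrightarrow> j < k \<longrightarrow> A i \<subset> A j"
      using Suc.hyps(1)[of "\<sigma> - {M}"] by auto
    have in_A: "A i \<in> \<sigma> - {M}" if "i < k" for i using A(1) that by auto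
    have "(A(k := M)) ` {..<Suc k} = insert M (A ` {..<k})"
      by (auto simp: lessThan_Suc)
    also have "\<dots> = \<sigma>" using A(1) M(1) by auto
    finally have "\<sigma> = (A(k := M)) ` {..<card \<sigma>}" using Suc.hyps(2) by simp
    moreover have "(A(k := M)) i \<subset> (A(k := M)) j" if "i < j" "j < card \<sigma>" for i j
    proof (cases "j = k")
      case True
      then show ?thesis using that(1) sub[OF in_A[of i]] by simp
    next
      case False
      then show ?thesis using that Suc.hyps(2) A(2) by simp
    qed
    ultimately show ?case by blast
  qed simp
  with that show thesis by blast
qed

text \<open>The largest vertex of a cycle would have two different neighbours on it, but on the line
  it has only one smaller neighbour.\<close>

lemma no_cycle_line: "\<not> cycle ((\<lambda>j. {j, Suc j}) ` {..<k}) p"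
proof
  let ?E = "(\<lambda>j. {j, Suc j}) ` {..<k}"
  assume "cycle ?E p"
  then have len: "3 \<le> length p" and d: "distinct p"
    and E: "\<And>i. i < length p \<Longrightarrow> {p ! i, p ! (Suc i mod length p)} \<in> ?E"
    unfolding cycle_def by auto
  have "p \<noteq> []" using len by auto
  then have "Max (set p) \<in> set p" by simp
  then obtain i where i: "i < length p" "p ! i = Max (set p)" by (auto simp: in_set_conv_nth)
  have below: "Suc (p ! a) = p ! i" if "a < length p" "{p ! i, p ! a} \<in> ?E" for a
  proof -
    have "p ! a \<le> p ! i" using that(1) i(2) by simp
    with that(2) show ?thesis by (auto simp: doubleton_eq_iff)
  qed
  \<comment> \<open>The cyclic successor and predecessor of \<open>i\<close>; they differ because
    the cycle has at least three vertices.\<close>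
  define nx where "nx = (if Suc i = length p then 0 else Suc i)"
  define pv where "pv = (if i = 0 then length p - 1 else i - 1)"
  have lt: "nx < length p" "pv < length p" and "nx \<noteq> pv"
    using i(1) len unfolding nx_def pv_def by auto
  have "Suc i mod length p = nx" "Suc pv mod length p = i"
    using i(1) len unfolding nx_def pv_def by auto
  then have "{p ! i, p ! nx} \<in> ?E" "{p ! i, p ! pv} \<in> ?E"
    using E[OF i(1)] E[OF lt(2)] by (simp_all add: insert_commute)
  then have "p ! nx = p ! pv" using below lt by (metis nat.inject)
  with d lt \<open>nx \<noteq> pv\<close> show False by (simp add: nth_eq_iff_index_eq)
qed

lemma path_list_chain_tree:
  assumes "\<sigma> \<noteq> {}" "finite \<sigma>"
  shows "path_list (chain_tree \<sigma>) [0..<Suc (card \<sigma>)]"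
proof -
  have "card \<sigma> \<noteq> 0" using assms by auto
  moreover have "{{[0..<Suc (card \<sigma>)] ! i, [0..<Suc (card \<sigma>)] ! Suc i} | i. Suc i < Suc (card \<sigma>)}
      = {{j, Suc j} | j. j < card \<sigma>}"
    by (intro Collect_cong ex_cong1) (auto simp del: upt_Suc)
  then have "{{[0..<Suc (card \<sigma>)] ! i, [0..<Suc (card \<sigma>)] ! Suc i} | i. Suc i < Suc (card \<sigma>)}
      = (\<lambda>j. {j, Suc j}) ` {..<card \<sigma>}"
    by auto
  ultimately show ?thesis
    unfolding path_list_def chain_tree_simps by (simp del: upt_Suc) auto
qed

text \<open>The indices of the members that miss \<open>i\<close> form an initial segment, and
  \<open>m\<close> is at least its length exactly when \<open>m\<close> lies outside it.\<close>

lemma chain_tree_mark_le_iff: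
  assumes A: "\<sigma> = A ` {..<card \<sigma>}" "\<And>i j. i < j \<Longrightarrow> j < card \<sigma> \<Longrightarrow> A i \<subset> A j"
    and m: "m < card \<sigma>"
  shows "mark (chain_tree \<sigma>) i \<le> m \<longleftrightarrow> i \<in> A m"
proof -
  let ?J = "{j. j < card \<sigma> \<and> i \<notin> A j}"
  have "inj_on A {..<card \<sigma>}"
    using A(2) by (intro linorder_inj_onI) auto
  then have "inj_on A ?J" by (rule inj_on_subset) auto
  moreover have "{B \<in> \<sigma>. i \<notin> B} = A ` ?J" using A(1) by auto
  ultimately have card: "mark (chain_tree \<sigma>) i = card ?J"
    unfolding chain_tree_simps by (simp add: card_image)
  have mono: "A j \<subseteq> A k" if "j \<le> k" "k < card \<sigma>" for j k
    using A(2)[of j k] that by (cases "j = k") auto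
  show ?thesis
  proof
    assume "i \<in> A m"
    then have "?J \<subseteq> {..<m}" using mono m by (force simp: not_le[symmetric])
    then show "mark (chain_tree \<sigma>) i \<le> m"
      using card_mono[of "{..<m}" ?J] unfolding card by simp
  next
    assume le: "mark (chain_tree \<sigma>) i \<le> m"
    show "i \<in> A m"
    proof (rule ccontr)
      assume "i \<notin> A m"
      then have "{..m} \<subseteq> ?J" using mono m by fastforce
      then have "card {..m} \<le> card ?J" by (intro card_mono) auto
      then show False using le unfolding card by simp
    qed
  qed
qed

text \<open>The end vertices carry the marks of the smallest member and of the complement of the
  largest, each of weight more than 1. An interior vertex has two edges, and strictness of the
  inclusion there supplies a mark of positive weight.\<close>

lemma chain_tree_stable:
  assumes w: "\<forall>i\<in>{1..n}. 0 < w i" and \<sigma>: "\<sigma> \<in> order_complex (heavy_subsets n w)"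
  shows "chain_tree \<sigma> \<in> stable_trees n w"
proof -
  let ?T = "chain_tree \<sigma>" and ?k = "card \<sigma>" and ?p = "[0..<Suc (card \<sigma>)]"
  have fin: "finite \<sigma>" and ne: "\<sigma> \<noteq> {}" and chain: "chain\<^sub>\<subseteq> \<sigma>" and sub: "\<sigma> \<subseteq> heavy_subsets n w"
    using \<sigma> unfolding order_complex_def chains_def by auto
  have k: "?k \<noteq> 0" using fin ne by auto
  note p = path_list_chain_tree[OF ne fin]
  have nth: "?p ! j = j" if "j \<le> ?k" for j
    using that by (simp del: upt_Suc)
  have conn: "(i, j) \<in> connected_by (edges ?T)" if "i \<le> j" "j \<le> ?k" for i j
  proof -
    have "(?p ! i, ?p ! j) \<in> connected_by (edges ?T)"
      using that nth_edge_in_edges[OF p] by (subst path_list_connected_by_iff[OF p]) auto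
    then show ?thesis using that nth by simp
  qed
  have "verts ?T \<times> verts ?T \<subseteq> connected_by (edges ?T)"
  proof clarify
    fix i j assume "i \<in> verts ?T" "j \<in> verts ?T"
    then show "(i, j) \<in> connected_by (edges ?T)"
      unfolding chain_tree_simps(1)
      using conn[of i j] connected_by_sym[OF conn[of j i]] by (cases "i \<le> j") auto
  qed
  moreover have "\<forall>e\<in>edges ?T. e \<subseteq> verts ?T \<and> card e = 2"
    unfolding chain_tree_simps by auto
  moreover have "mark ?T ` {1..n} \<subseteq> verts ?T"
    unfolding chain_tree_simps using fin by (auto intro: card_mono)
  ultimately have tree: "marked_tree n ?T"
    unfolding marked_tree_def using no_cycle_line by (auto simp: chain_tree_simps)
  obtain A where A: "\<sigma> = A ` {..<?k}" "\<And>i j. i < j \<Longrightarrow> j < ?k \<Longrightarrow> A i \<subset> A j"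
    using finite_chain_enum[OF fin chain] by metis
  note mark = chain_tree_mark_le_iff[OF A]
  have heavy: "A m \<subseteq> {1..n}" "sum w (A m) > 1" "sum w ({1..n} - A m) > 1" if "m < ?k" for m
  proof -
    have "A m \<in> heavy_subsets n w" using that A(1) sub by blast
    then show "A m \<subseteq> {1..n}" "sum w (A m) > 1" "sum w ({1..n} - A m) > 1"
      unfolding heavy_subsets_def by simp_all
  qed
  have stable: "real (valence ?T v) + sum w {i \<in> {1..n}. mark ?T i = v} > 2"
    if v: "v \<in> verts ?T" for v
  proof -
    have "v \<le> ?k" using v by (simp add: chain_tree_simps)
    then have val: "valence ?T v = (if v = 0 \<or> v = ?k then 1 else 2)"
      using path_list_valence[OF p, of v] nth[of v] by (simp del: upt_Suc)
    consider "v = 0" | "v = ?k" | "0 < v" "v < ?k" using \<open>v \<le> ?k\<close> by linarith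
    then show ?thesis
    proof cases
      case 1
      have "{i \<in> {1..n}. mark ?T i = v} = A 0"
        using mark[of 0] k heavy(1)[of 0] 1 by auto
      then show ?thesis using val 1 heavy(2)[of 0] k by simp
    next
      case 2
      have "mark ?T i = ?k \<longleftrightarrow> i \<notin> A (?k - 1)" for i
      proof -
        have "mark ?T i \<le> ?k" unfolding chain_tree_simps using fin by (auto intro: card_mono)
        then show ?thesis using mark[of "?k - 1" i] k by auto
      qed
      then have "{i \<in> {1..n}. mark ?T i = v} = {1..n} - A (?k - 1)" using 2 by auto
      then show ?thesis using val 2 heavy(3)[of "?k - 1"] k by simp
    next
      case 3
      then have "A (v - 1) \<subset> A v" using A(2) by simp
      then obtain i where i: "i \<in> A v" "i \<notin> A (v - 1)" by blast
      then have "mark ?T i \<le> v" "\<not> mark ?T i \<le> v - 1" using mark 3 by auto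
      then have "mark ?T i = v" by simp
      moreover have "i \<in> {1..n}" using i(1) heavy(1) 3 by blast
      ultimately have "0 < sum w {i \<in> {1..n}. mark ?T i = v}"
        using w by (intro sum_pos) auto
      then show ?thesis using val 3 by simp
    qed
  qed
  with tree show ?thesis unfolding stable_trees_def by blast
qed

lemma oriented_path_chain:
  assumes w: "\<forall>i\<in>{1..n}. 0 < w i" and \<sigma>: "\<sigma> \<in> order_complex (heavy_subsets n w)"
  shows "oriented_path n w (chain_tree \<sigma>) (case_label 0 (card \<sigma>)) [0..<Suc (card \<sigma>)]"
proof -
  have "\<sigma> \<noteq> {}" "finite \<sigma>" using \<sigma> unfolding order_complex_def by auto
  note path_list_chain_tree[OF this]
  moreover have "hd [0..<Suc (card \<sigma>)] = 0" by (subst upt_rec) simp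
  ultimately show ?thesis
    using chain_tree_stable[OF w \<sigma>] w by (simp add: oriented_path_def)
qed

lemma chain_path_oriented:
  assumes "\<forall>i\<in>{1..n}. 0 < w i" and "\<sigma> \<in> order_complex (heavy_subsets n w)"
  shows "chain_path \<sigma> \<in> oriented_paths n w"
  using oriented_path.oriented[OF oriented_path_chain[OF assms]] unfolding chain_path_def .

lemma side_chain_path_image:
  assumes w: "\<forall>i\<in>{1..n}. 0 < w i" and \<sigma>: "\<sigma> \<in> order_complex (heavy_subsets n w)"
  shows "side n (chain_path \<sigma>) ` oedges (chain_path \<sigma>) = \<sigma>"
proof -
  let ?T = "chain_tree \<sigma>" and ?k = "card \<sigma>" and ?p = "[0..<Suc (card \<sigma>)]"
  interpret oriented_path n w ?T "case_label 0 ?k" ?p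
    using oriented_path_chain[OF w \<sigma>] .
  have fin: "finite \<sigma>" and chain: "chain\<^sub>\<subseteq> \<sigma>" and sub: "\<sigma> \<subseteq> heavy_subsets n w"
    using \<sigma> unfolding order_complex_def chains_def by auto
  obtain A where A: "\<sigma> = A ` {..<?k}" "\<And>i j. i < j \<Longrightarrow> j < ?k \<Longrightarrow> A i \<subset> A j"
    using finite_chain_enum[OF fin chain] by metis
  have nth: "?p ! j = j" if "j \<le> ?k" for j using that by (simp del: upt_Suc)
  have pos_eq: "pos i = mark ?T i" if "i \<in> {1..n}" for i
    using pos[OF that] nth[of "pos i"] by (simp del: upt_Suc)
  have "side n (chain_path \<sigma>) {m, Suc m} = A m" if m: "m < ?k" for m
  proof -
    have "A m \<in> heavy_subsets n w" using m A(1) sub by blast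
    then have "A m \<subseteq> {1..n}" unfolding heavy_subsets_def by blast
    moreover have "side n (chain_path \<sigma>) {m, Suc m} = {i \<in> {1..n}. pos i \<le> m}"
      using side_nth_edge[of m] m nth[of m] nth[of "Suc m"] unfolding chain_path_def
      by (simp del: upt_Suc)
    ultimately show ?thesis
      using pos_eq chain_tree_mark_le_iff[OF A m] by auto
  qed
  then have "side n (chain_path \<sigma>) ` oedges (chain_path \<sigma>) = A ` {..<?k}"
    unfolding chain_path_def by (simp add: chain_tree_simps image_image)
  with A(1) show ?thesis by simp
qed

section \<open>Barycentric coordinates\<close>

text \<open>For an oriented path the sum has at most one term, because \<open>side\<close> is
  injective on edges. Writing it as a sum gives 0 at sets that are not left parts and makes the
  dependence on the lengths visibly continuous.\<close>

definition bary :: "nat \<Rightarrow> otree \<times> (nat set \<Rightarrow> real) \<Rightarrow> nat set \<Rightarrow> real" where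
  "bary n x A = sum (snd x) {e \<in> oedges (fst x). side n (fst x) e = A}"

lemma stable_trees_finite_edges:
  assumes "T \<in> stable_trees n w"
  shows "finite (edges T)"
proof -
  have "finite (verts T)" "edges T \<subseteq> Pow (verts T)"
    using assms unfolding stable_trees_def marked_tree_def by auto
  then show ?thesis by (meson finite_Pow_iff finite_subset)
qed

lemma std_simplex_nonempty: "l \<in> std_simplex E \<Longrightarrow> E \<noteq> {}"
  unfolding std_simplex_def by auto

lemma bary_nonneg: "l \<in> std_simplex E \<Longrightarrow> 0 \<le> bary n (X, l) A"
  unfolding bary_def std_simplex_def by (auto intro: sum_nonneg)

context oriented_path
begin

lemma bary_side: "e \<in> edges T \<Longrightarrow> bary n ((T, r), l) (side n (T, r) e) = l e"
proof -
  assume e: "e \<in> edges T"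
  then have "{e' \<in> edges T. side n (T, r) e' = side n (T, r) e} = {e}"
    using inj_on_side by (auto dest: inj_onD)
  then show ?thesis unfolding bary_def by simp
qed

lemma bary_eq_0: "A \<notin> side n (T, r) ` edges T \<Longrightarrow> bary n ((T, r), l) A = 0"
  unfolding bary_def by (auto intro: sum.neutral)

lemma bary_in_std_simplex:
  assumes "l \<in> std_simplex (edges T)"
  shows "bary n ((T, r), l) \<in> std_simplex (side n (T, r) ` edges T)"
proof -
  have "sum (bary n ((T, r), l)) (side n (T, r) ` edges T) = sum l (edges T)"
    by (simp add: sum.reindex inj_on_side bary_side)
  then show ?thesis
    using assms bary_nonneg[OF assms] bary_eq_0 unfolding std_simplex_def by auto
qed

end

lemma oglueI:
  assumes "(T, r) \<in> oriented_paths n w" "l \<in> std_simplex (edges T)"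
    and "(T', r') \<in> oriented_paths n w" "l' \<in> std_simplex (edges T')"
    and "contraction n T F T' c" "\<And>x. r' x = c (r x)"
    and "\<And>e. e \<in> F \<Longrightarrow> l e = 0" "\<And>e. e \<in> edges T - F \<Longrightarrow> l' (c ` e) = l e"
  shows "(((T, r), l), ((T', r'), l')) \<in> oglue n w"
proof -
  have "\<exists>F c. contraction n T F T' c \<and> (\<forall>x. r' x = c (r x)) \<and>
      (\<forall>e\<in>F. l e = 0) \<and> (\<forall>e\<in>edges T - F. l' (c ` e) = l e)"
    using assms(5-8) by (intro exI[of _ F] exI[of _ c]) simp
  then show ?thesis using assms(1-4) unfolding oglue_def by simp
qed

text \<open>Contracted edges have length 0 and drop out of the sum; the surviving edges correspond
  bijectively, with the same left parts and lengths.\<close>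

lemma bary_oglue:
  assumes w: "\<forall>i\<in>{1..n}. 0 < w i" and xy: "(x, y) \<in> oglue n w"
  shows "bary n x = bary n y"
proof -
  obtain T r l T' r' l' F c where x: "x = ((T, r), l)" and y: "y = ((T', r'), l')"
    and T: "(T, r) \<in> oriented_paths n w" and con: "contraction n T F T' c"
    and r': "\<forall>x. r' x = c (r x)" and F0: "\<forall>e\<in>F. l e = 0"
    and l': "\<forall>e\<in>edges T - F. l' (c ` e) = l e"
    using xy unfolding oglue_def by auto
  have stable: "T \<in> stable_trees n w" and left: "r LabelL \<in> verts T"
    using T unfolding oriented_paths_iff leaves_def by auto
  then have tree: "marked_tree n T" unfolding stable_trees_def by blast
  note fin = stable_trees_finite_edges[OF stable]
  have side: "side n (T', r') (c ` e) = side n (T, r) e" if "e \<in> edges T - F" for e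
    using side_contraction[OF tree con that, of r r'] left r' by blast
  show ?thesis
  proof
    fix A
    let ?B = "{e \<in> edges T - F. side n (T, r) e = A}"
    have "bary n x A = sum l ?B"
      unfolding bary_def x using fin F0 by (auto intro!: sum.mono_neutral_right)
    also have "\<dots> = sum (l' \<circ> image c) ?B"
      using l' by (intro sum.cong) auto
    also have "\<dots> = sum l' (image c ` ?B)"
      using contraction_inj_on_edges[OF tree con]
      by (intro sum.reindex[symmetric]) (auto intro: inj_on_subset)
    also have "image c ` ?B = {e \<in> edges T'. side n (T', r') e = A}"
      using side by (auto simp: contraction_edges[OF con])
    also have "sum l' \<dots> = bary n y A"
      unfolding bary_def y by simp
    finally show "bary n x A = bary n y A" .
  qed
qed

section \<open>Classes of the generated equivalence relation\<close>

lemma glued_class_refl: "x \<in> glued_class R x"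
  unfolding glued_class_def by simp

lemma glued_class_eqI:
  assumes "y \<in> glued_class R x"
  shows "glued_class R y = glued_class R x"
proof -
  have "sym ((R \<union> R\<inverse>)\<^sup>*)" by (intro sym_rtrancl) (auto simp: sym_def)
  with assms have "(x, y) \<in> (R \<union> R\<inverse>)\<^sup>*" "(y, x) \<in> (R \<union> R\<inverse>)\<^sup>*"
    unfolding glued_class_def by (auto dest: symD)
  then show ?thesis
    unfolding glued_class_def by (auto dest: rtrancl_trans)
qed

lemma glued_class_eq_iff: "glued_class R y = glued_class R x \<longleftrightarrow> y \<in> glued_class R x"
  using glued_class_eqI glued_class_refl by metis

lemma glued_class_glue: "(x, y) \<in> R \<Longrightarrow> glued_class R x = glued_class R y"
  by (rule glued_class_eqI[symmetric]) (auto simp: glued_class_def)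

lemma glued_class_induct [consumes 1, case_names refl forward backward]:
  assumes "y \<in> glued_class R x" and "P x"
    and "\<And>y z. y \<in> glued_class R x \<Longrightarrow> (y, z) \<in> R \<Longrightarrow> P y \<Longrightarrow> P z"
    and "\<And>y z. y \<in> glued_class R x \<Longrightarrow> (z, y) \<in> R \<Longrightarrow> P y \<Longrightarrow> P z"
  shows "P y"
proof -
  have "(x, y) \<in> (R \<union> R\<inverse>)\<^sup>*" using assms(1) unfolding glued_class_def by simp
  then show ?thesis
  proof (induction rule: rtrancl_induct)
    case (step y z)
    moreover have "y \<in> glued_class R x" using step.hyps unfolding glued_class_def by simp
    ultimately show ?case using assms(3,4) by blast
  qed (rule assms)
qed

lemma bary_class:
  assumes "\<forall>i\<in>{1..n}. 0 < w i" and "y \<in> glued_class (oglue n w) x"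
  shows "bary n y = bary n x"
  using assms(2) by (induction rule: glued_class_induct) (use bary_oglue[OF assms(1)] in auto)

section \<open>Numbering the vertices after a contraction\<close>

definition count_below :: "(nat \<Rightarrow> bool) \<Rightarrow> nat \<Rightarrow> nat" where
  "count_below Q j = card {m. m < j \<and> Q m}"

lemma count_below_0 [simp]: "count_below Q 0 = 0"
  unfolding count_below_def by simp

lemma count_below_Suc [simp]: "count_below Q (Suc j) = count_below Q j + (if Q j then 1 else 0)"
proof -
  have "{m. m < Suc j \<and> Q m} = {m. m < j \<and> Q m} \<union> (if Q j then {j} else {})"
    by (auto simp: less_Suc_eq)
  then show ?thesis unfolding count_below_def by simp
qed

lemma count_below_mono: "i \<le> j \<Longrightarrow> count_below Q i \<le> count_below Q j"
  unfolding count_below_def by (rule card_mono) auto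

text \<open>With \<open>Q\<close> selecting the surviving edges, this is the condition under which
  two vertices of a path are contracted to the same one.\<close>

lemma count_below_eq_iff:
  assumes "i \<le> j"
  shows "count_below Q i = count_below Q j \<longleftrightarrow> (\<forall>m. i \<le> m \<and> m < j \<longrightarrow> \<not> Q m)"
  using assms
proof (induction j rule: dec_induct)
  case (step k)
  show ?case
  proof (cases "Q k")
    case True
    then show ?thesis using step.hyps count_below_mono[of i k Q] by auto
  next
    case False
    then show ?thesis using step by (auto simp: less_Suc_eq)
  qed
qed auto

lemma count_below_image: "count_below Q ` {..j} = {..count_below Q j}"
  by (induction j) (auto simp: atMost_Suc)

text \<open>The surviving edges are renumbered consecutively from 0, as the edges of a
  \<open>chain_tree\<close> are.\<close>

lemma count_below_image_jumps: "count_below Q ` {m. m < j \<and> Q m} = {..<count_below Q j}"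
proof (induction j)
  case (Suc j)
  have "{m. m < Suc j \<and> Q m} = {m. m < j \<and> Q m} \<union> (if Q j then {j} else {})"
    by (auto simp: less_Suc_eq)
  with Suc show ?case by (auto simp: lessThan_Suc)
qed simp

text \<open>This inverts \<open>bary\<close> on the simplex of \<sigma>. The default 0 off the edges
  is what membership in \<open>std_simplex\<close> requires.\<close>

definition lift_coords :: "nat \<Rightarrow> nat set set \<Rightarrow> (nat set \<Rightarrow> real) \<Rightarrow> nat set \<Rightarrow> real" where
  "lift_coords n \<sigma> f e = (if e \<in> oedges (chain_path \<sigma>) then f (side n (chain_path \<sigma>) e) else 0)"

definition chain_point :: "nat \<Rightarrow> nat set set \<Rightarrow> (nat set \<Rightarrow> real) \<Rightarrow> otree \<times> (nat set \<Rightarrow> real)" where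
  "chain_point n \<sigma> f = (chain_path \<sigma>, lift_coords n \<sigma> f)"

lemma chain_point_props:
  assumes w: "\<forall>i\<in>{1..n}. 0 < w i" and \<sigma>: "\<sigma> \<in> order_complex (heavy_subsets n w)"
    and f: "f \<in> std_simplex \<sigma>"
  shows "lift_coords n \<sigma> f \<in> std_simplex (oedges (chain_path \<sigma>))"
    and "bary n (chain_point n \<sigma> f) = f"
proof -
  let ?T = "chain_tree \<sigma>" and ?r = "case_label 0 (card \<sigma>) :: label \<Rightarrow> nat"
  interpret oriented_path n w ?T ?r "[0..<Suc (card \<sigma>)]"
    using oriented_path_chain[OF w \<sigma>] .
  note image = side_chain_path_image[OF w \<sigma>]
  have "sum (lift_coords n \<sigma> f) (oedges (chain_path \<sigma>))
      = (\<Sum>e\<in>oedges (chain_path \<sigma>). f (side n (chain_path \<sigma>) e))"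
    by (intro sum.cong) (auto simp: lift_coords_def)
  also have "\<dots> = sum f (side n (chain_path \<sigma>) ` oedges (chain_path \<sigma>))"
    using inj_on_side unfolding chain_path_def by (simp add: sum.reindex)
  finally have "sum (lift_coords n \<sigma> f) (oedges (chain_path \<sigma>)) = sum f \<sigma>"
    unfolding image .
  then show "lift_coords n \<sigma> f \<in> std_simplex (oedges (chain_path \<sigma>))"
    using f unfolding std_simplex_def by (auto simp: lift_coords_def)
  show "bary n (chain_point n \<sigma> f) = f"
  proof
    fix A
    show "bary n (chain_point n \<sigma> f) A = f A"
    proof (cases "A \<in> \<sigma>")
      case True
      then obtain e where e: "e \<in> edges ?T" "A = side n (chain_path \<sigma>) e"
        using image unfolding chain_path_def by auto
      then show ?thesis
        using bary_side[OF e(1)] unfolding chain_point_def chain_path_def lift_coords_def by simp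
    next
      case False
      then have "bary n (chain_point n \<sigma> f) A = 0"
        using bary_eq_0 image unfolding chain_point_def chain_path_def by simp
      then show ?thesis using f False unfolding std_simplex_def by auto
    qed
  qed
qed

section \<open>Normal form of a point\<close>

lemma order_complex_subset:
  assumes "\<tau> \<in> order_complex P" "\<sigma> \<subseteq> \<tau>" "\<sigma> \<noteq> {}"
  shows "\<sigma> \<in> order_complex P"
proof -
  have "finite \<tau>" "\<tau> \<subseteq> P" "chain\<^sub>\<subseteq> \<tau>" using assms(1) unfolding order_complex_def chains_def by auto
  moreover have "chain\<^sub>\<subseteq> \<sigma>" using \<open>chain\<^sub>\<subseteq> \<tau>\<close> assms(2) unfolding chain_subset_def by (meson subsetD)
  ultimately show ?thesis
    using assms finite_subset[of \<sigma> \<tau>] unfolding order_complex_def chains_def by simp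
qed

context oriented_path
begin

text \<open>Contract all edges of length zero. The left parts of the other edges are the sets with
  nonzero coordinate, and numbering the remaining vertices from left to right yields
  \<open>chain_tree\<close> of these sets itself, not merely an isomorphic tree. The point reached
  is thus determined by the coordinates.\<close>

lemma normal_form:
  assumes l: "l \<in> std_simplex (edges T)"
  defines "\<sigma> \<equiv> {A. bary n ((T, r), l) A \<noteq> 0}"
  shows "(((T, r), l), chain_point n \<sigma> (bary n ((T, r), l))) \<in> oglue n w"
    and "\<sigma> \<in> order_complex (heavy_subsets n w)"
proof -
  let ?f = "bary n ((T, r), l)" and ?N = "length p - 1"
  let ?s = "\<lambda>m. side n (T, r) (nth_edge p m)"
  define Q where "Q m \<longleftrightarrow> l (nth_edge p m) \<noteq> 0" for m
  define F where "F = {e \<in> edges T. l e = 0}"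
  have F: "F \<subseteq> edges T" unfolding F_def by blast
  have \<sigma>_edges: "\<sigma> = side n (T, r) ` (edges T - F)"
  proof (intro equalityI subsetI)
    fix A assume "A \<in> \<sigma>"
    then have A: "?f A \<noteq> 0" unfolding \<sigma>_def by simp
    then obtain e where "e \<in> edges T" "A = side n (T, r) e"
      using bary_eq_0 by blast
    then show "A \<in> side n (T, r) ` (edges T - F)"
      using A bary_side unfolding F_def by auto
  qed (auto simp: \<sigma>_def F_def bary_side)
  have "\<sigma> \<noteq> {}"
  proof
    assume "\<sigma> = {}"
    then have "\<forall>e\<in>edges T. l e = 0" unfolding \<sigma>_edges F_def by auto
    then have "sum l (edges T) = 0" by (intro sum.neutral)
    then show False using l unfolding std_simplex_def by simp
  qed
  have \<sigma>_sub: "\<sigma> \<subseteq> side n (T, r) ` edges T" unfolding \<sigma>_edges by blast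
  show \<sigma>: "\<sigma> \<in> order_complex (heavy_subsets n w)"
    using order_complex_subset[OF side_image \<sigma>_sub \<open>\<sigma> \<noteq> {}\<close>] .
  have nonF: "edges T - F = nth_edge p ` {m. m < ?N \<and> Q m}"
    unfolding F_def Q_def edges_path_list[OF path] by auto
  have inj_s: "inj_on ?s {m. m < ?N}"
  proof -
    have "inj_on (nth_edge p) {m. m < ?N}"
      using inj_on_nth_edge[OF dist] by (rule inj_on_subset) auto
    moreover have "nth_edge p ` {m. m < ?N} \<subseteq> edges T"
      unfolding edges_path_list[OF path] by auto
    ultimately show ?thesis
      using inj_on_side comp_inj_on[of "nth_edge p" "{m. m < ?N}" "side n (T, r)"]
      by (auto simp: comp_def intro: inj_on_subset)
  qed
  have \<sigma>_s: "\<sigma> = ?s ` {m. m < ?N \<and> Q m}" unfolding \<sigma>_edges nonF by auto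
  have card_\<sigma>: "card \<sigma> = count_below Q ?N"
    unfolding \<sigma>_s count_below_def by (intro card_image inj_on_subset[OF inj_s]) auto
  \<comment> \<open>A vertex goes to the number of edges of nonzero length that precede it;
    \<open>inv_into\<close> recovers its position on the path.\<close>
  define c where "c v = count_below Q (inv_into {..<length p} (nth p) v)" for v
  have c_nth: "c (p ! j) = count_below Q j" if "j < length p" for j
    unfolding c_def using that dist by (subst inv_into_f_f) (auto simp: inj_on_nth)
  have verts_nth: "verts T = nth p ` {..?N}"
  proof -
    have "{..<length p} = {..?N}" using len by auto
    moreover have "set p = nth p ` {..<length p}" by (auto simp: set_conv_nth)
    ultimately show ?thesis by (simp only: verts)
  qed
  have F_iff: "nth_edge p m \<in> F \<longleftrightarrow> \<not> Q m" if "Suc m < length p" for m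
    using nth_edge_in_edges[OF path that] unfolding F_def Q_def by simp
  have c_le: "c (p ! i) = c (p ! j) \<longleftrightarrow> (p ! i, p ! j) \<in> connected_by F"
    if "i \<le> j" "j < length p" for i j
    using that F_iff
    by (subst path_list_connected_by_iff[OF path F that]) (auto simp: c_nth count_below_eq_iff)
  have c_eq: "c u = c v \<longleftrightarrow> (u, v) \<in> connected_by F" if "u \<in> verts T" "v \<in> verts T" for u v
  proof -
    have "u \<in> set p" "v \<in> set p" using that by (simp_all only: verts)
    then obtain i j where ij: "i < length p" "u = p ! i" "j < length p" "v = p ! j"
      by (metis in_set_conv_nth)
    show ?thesis
    proof (cases "i \<le> j")
      case True
      then show ?thesis using c_le ij by simp
    next
      case False
      then have "c v = c u \<longleftrightarrow> (v, u) \<in> connected_by F" using c_le[of j i] ij by simp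
      then show ?thesis by (metis connected_by_sym)
    qed
  qed
  have c_edge: "c ` nth_edge p m = {count_below Q m, Suc (count_below Q m)}" if "m < ?N" "Q m" for m
    using that by (simp add: c_nth)
  have con: "contraction n T F (chain_tree \<sigma>) c"
    unfolding contraction_def
  proof (intro conjI F ballI)
    have "c ` verts T = count_below Q ` {..?N}"
      unfolding verts_nth image_image using len by (intro image_cong refl c_nth) auto
    then show "c ` verts T = verts (chain_tree \<sigma>)"
      unfolding chain_tree_simps card_\<sigma> count_below_image .
    show "c u = c v \<longleftrightarrow> (u, v) \<in> connected_by F" if "u \<in> verts T" "v \<in> verts T" for u v
      using c_eq that .
    have "(\<lambda>e. c ` e) ` (edges T - F) = (\<lambda>m. {count_below Q m, Suc (count_below Q m)}) ` {m. m < ?N \<and> Q m}"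
      unfolding nonF image_image by (intro image_cong refl) (use c_edge in blast)
    also have "\<dots> = (\<lambda>j. {j, Suc j}) ` count_below Q ` {m. m < ?N \<and> Q m}"
      by (simp add: image_image)
    finally show "edges (chain_tree \<sigma>) = (\<lambda>e. c ` e) ` (edges T - F)"
      unfolding chain_tree_simps card_\<sigma> count_below_image_jumps ..
  next
    fix i assume i: "i \<in> {1..n}"
    \<comment> \<open>A left part misses \<open>i\<close> exactly when its edge comes before the
      vertex marked \<open>i\<close>, so the count defining the mark in \<open>chain_tree\<close> is
      the count defining \<open>c\<close>.\<close>
    have "{A \<in> \<sigma>. i \<notin> A} = ?s ` {m. m < pos i \<and> Q m}"
    proof -
      have "i \<in> ?s m \<longleftrightarrow> pos i \<le> m" if "m < ?N" for m
        using that i by (subst side_nth_edge) auto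
      then have "{m. m < pos i \<and> Q m} = {m \<in> {m. m < ?N \<and> Q m}. i \<notin> ?s m}"
        using pos(1)[OF i] by (auto simp: not_le)
      then show ?thesis unfolding \<sigma>_s by blast
    qed
    moreover have "inj_on ?s {m. m < pos i \<and> Q m}"
      by (rule inj_on_subset[OF inj_s]) (use pos(1)[OF i] in auto)
    ultimately have "mark (chain_tree \<sigma>) i = count_below Q (pos i)"
      unfolding chain_tree_simps count_below_def by (simp add: card_image)
    then show "mark (chain_tree \<sigma>) i = c (mark T i)"
      using c_nth[OF pos(1)[OF i]] pos(2)[OF i] by simp
  qed
  have "p \<noteq> []" using len by auto
  have c_orient: "snd (chain_path \<sigma>) x = c (r x)" for x
  proof (cases x)
    case LabelL
    then show ?thesis unfolding chain_path_def using c_nth[of 0] \<open>p \<noteq> []\<close> left_nth by simp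
  next
    case LabelR
    then show ?thesis unfolding chain_path_def using c_nth[of ?N] \<open>p \<noteq> []\<close> right_nth card_\<sigma> by simp
  qed
  have "?f \<in> std_simplex (side n (T, r) ` edges T)" using bary_in_std_simplex[OF l] .
  moreover have "sum ?f \<sigma> = sum ?f (side n (T, r) ` edges T)"
    using stable_trees_finite_edges[OF stable] \<sigma>_sub
    by (intro sum.mono_neutral_left) (auto simp: \<sigma>_def)
  ultimately have f: "?f \<in> std_simplex \<sigma>"
    unfolding std_simplex_def by (simp add: \<sigma>_def)
  have lift: "lift_coords n \<sigma> ?f (c ` e) = l e" if e: "e \<in> edges T - F" for e
  proof -
    have tree: "marked_tree n T" using stable unfolding stable_trees_def by blast
    have "r LabelL \<in> verts T" using left_nth \<open>p \<noteq> []\<close> verts nth_mem[of 0 p] by simp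
    then have "side n (chain_path \<sigma>) (c ` e) = side n (T, r) e"
      using side_contraction[OF tree con e, of r "snd (chain_path \<sigma>)"] c_orient[of LabelL]
      unfolding chain_path_def by simp
    moreover have "c ` e \<in> oedges (chain_path \<sigma>)"
      using contracted_edge[OF con e] unfolding chain_path_def by simp
    ultimately show ?thesis
      using bary_side e unfolding lift_coords_def by simp
  qed
  have "(chain_tree \<sigma>, snd (chain_path \<sigma>)) \<in> oriented_paths n w"
    using chain_path_oriented[OF weight_pos \<sigma>] unfolding chain_path_def by simp
  moreover have "lift_coords n \<sigma> ?f \<in> std_simplex (edges (chain_tree \<sigma>))"
    using chain_point_props(1)[OF weight_pos \<sigma> f] unfolding chain_path_def by simp
  moreover have "l e = 0" if "e \<in> F" for e using that unfolding F_def by simp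
  moreover have "chain_point n \<sigma> ?f = ((chain_tree \<sigma>, snd (chain_path \<sigma>)), lift_coords n \<sigma> ?f)"
    unfolding chain_point_def chain_path_def by simp
  ultimately show "(((T, r), l), chain_point n \<sigma> ?f) \<in> oglue n w"
    using oglueI[OF oriented l _ _ con c_orient _ lift] by metis
qed

end

section \<open>The realization of the order complex\<close>

lemma topspace_glued_space_iff:
  "x \<in> topspace (glued_space S E R) \<longleftrightarrow>
     (\<exists>T\<in>S. \<exists>l\<in>std_simplex (E T). x = glued_class R (T, l))"
  unfolding topspace_glued_space by auto

lemma glued_class_in_topspace:
  "T \<in> S \<Longrightarrow> l \<in> std_simplex (E T) \<Longrightarrow> glued_class R (T, l) \<in> topspace (glued_space S E R)"
  unfolding topspace_glued_space_iff by blast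

lemma openin_glued_space_iff:
  "openin (glued_space S E R) U \<longleftrightarrow> U \<subseteq> topspace (glued_space S E R) \<and>
     (\<forall>T\<in>S. openin (top_of_set (std_simplex (E T)))
        {l \<in> std_simplex (E T). glued_class R (T, l) \<in> U})"
  unfolding openin_glued_space glued_open_def topspace_glued_space ..

lemma continuous_map_glued_class:
  assumes "T \<in> S"
  shows "continuous_map (top_of_set (std_simplex (E T))) (glued_space S E R)
    (\<lambda>l. glued_class R (T, l))"
  unfolding continuous_map
proof (intro conjI allI impI)
  show "(\<lambda>l. glued_class R (T, l)) ` topspace (top_of_set (std_simplex (E T)))
      \<subseteq> topspace (glued_space S E R)"
    using assms by (auto intro: glued_class_in_topspace)
  fix U assume "openin (glued_space S E R) U"
  with assms show "openin (top_of_set (std_simplex (E T)))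
      {l \<in> topspace (top_of_set (std_simplex (E T))). glued_class R (T, l) \<in> U}"
    unfolding openin_glued_space_iff by simp
qed

lemma continuous_map_glued_space:
  assumes "\<And>T. T \<in> S \<Longrightarrow>
    continuous_map (top_of_set (std_simplex (E T))) Y (\<lambda>l. f (glued_class R (T, l)))"
  shows "continuous_map (glued_space S E R) Y f"
  unfolding continuous_map
proof (intro conjI allI impI)
  let ?X = "glued_space S E R"
  show "f ` topspace ?X \<subseteq> topspace Y"
    using continuous_map_image_subset_topspace[OF assms] by (force simp: topspace_glued_space_iff)
  fix U assume U: "openin Y U"
  have "openin (top_of_set (std_simplex (E T)))
      {l \<in> std_simplex (E T). glued_class R (T, l) \<in> {x \<in> topspace ?X. f x \<in> U}}"
    if T: "T \<in> S" for T
  proof -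
    have "{l \<in> std_simplex (E T). glued_class R (T, l) \<in> {x \<in> topspace ?X. f x \<in> U}}
        = {l \<in> topspace (top_of_set (std_simplex (E T))). f (glued_class R (T, l)) \<in> U}"
      using T by (auto intro: glued_class_in_topspace)
    then show ?thesis using openin_continuous_map_preimage[OF assms[OF T] U] by (simp only:)
  qed
  then show "openin ?X {x \<in> topspace ?X. f x \<in> U}"
    unfolding openin_glued_space_iff by blast
qed

lemma continuous_on_coordinate: "continuous_on S (\<lambda>l :: 'a \<Rightarrow> real. l e)"
  using continuous_on_product_coordinates by (rule continuous_on_subset) simp

lemma continuous_on_sum_coordinates: "continuous_on S (\<lambda>l :: 'a \<Rightarrow> real. sum l B)"
  by (rule continuous_on_sum[where f = "\<lambda>e l. l e"]) (rule continuous_on_coordinate)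

section \<open>Topology of a finite complex\<close>

lemma closed_std_simplex: "closed (std_simplex E)"
proof -
  have "continuous_on UNIV (\<lambda>l :: 'a \<Rightarrow> real. sum l E)"
    by (rule continuous_on_sum_coordinates)
  then show ?thesis
    unfolding std_simplex_def
    by (intro closed_Collect_conj closed_Collect_all closed_Collect_imp open_Collect_const
        closed_Collect_le closed_Collect_eq continuous_on_const continuous_on_product_coordinates)
qed

lemma finite_order_complex:
  assumes "finite P"
  shows "finite (order_complex P)"
proof -
  have "order_complex P \<subseteq> Pow P" unfolding order_complex_def chains_def by auto
  with assms show ?thesis by (meson finite_Pow_iff finite_subset)
qed

text \<open>The complement of \<open>W\<close> is the union of its parts in the individual
  simplices. Each part is closed because the simplex is, and a finite union of closed sets is
  closed.\<close>

lemma openin_realization: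
  assumes fin: "finite K" and W: "W \<subseteq> (\<Union>\<sigma>\<in>K. std_simplex \<sigma>)"
    and op: "\<And>\<sigma>. \<sigma> \<in> K \<Longrightarrow> openin (top_of_set (std_simplex \<sigma>)) (std_simplex \<sigma> \<inter> W)"
  shows "openin (realization K) W"
proof -
  let ?Z = "\<Union>\<sigma>\<in>K. std_simplex \<sigma>"
  have "closed (std_simplex \<sigma> - W)" if "\<sigma> \<in> K" for \<sigma>
  proof -
    have "closedin (top_of_set (std_simplex \<sigma>)) (std_simplex \<sigma> - std_simplex \<sigma> \<inter> W)"
      using op[OF that] by (intro closedin_diff) auto
    then have "closed (std_simplex \<sigma> - std_simplex \<sigma> \<inter> W)"
      using closed_std_simplex closedin_closed_trans by blast
    then show ?thesis by (simp add: Diff_Int)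
  qed
  then have "closed (\<Union>\<sigma>\<in>K. std_simplex \<sigma> - W)" using fin by (intro closed_UN ballI)
  moreover have "?Z - W = (\<Union>\<sigma>\<in>K. std_simplex \<sigma> - W)" by blast
  ultimately have "closed (?Z - W)" by (simp only:)
  then have "closedin (top_of_set ?Z) (?Z - W)"
    by (intro closed_subset Diff_subset)
  then have "openin (top_of_set ?Z) (?Z - (?Z - W))"
    by (intro openin_diff openin_subtopology_self)
  moreover have "?Z - (?Z - W) = W" using W by blast
  ultimately show ?thesis unfolding realization_def by simp
qed

text \<open>The chosen representative does not matter for a class of oriented points, since
  \<open>bary\<close> is constant on it (\<open>bary_class\<close>).\<close>

definition coords :: "nat \<Rightarrow> (otree \<times> (nat set \<Rightarrow> real)) set \<Rightarrow> nat set \<Rightarrow> real" where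
  "coords n x = bary n (SOME y. y \<in> x)"

section \<open>The coordinate map as a simplicial isomorphism\<close>

locale weights =
  fixes n :: nat and w :: "nat \<Rightarrow> real"
  assumes weight_pos: "\<forall>i\<in>{1..n}. 0 < w i"
begin

abbreviation "heavy_complex \<equiv> order_complex (heavy_subsets n w)"

lemma finite_heavy_complex: "finite heavy_complex"
  by (intro finite_order_complex finite_subset[of "heavy_subsets n w" "Pow {1..n}"])
    (auto simp: heavy_subsets_def)

lemma coords_class: "coords n (glued_class (oglue n w) x) = bary n x"
  unfolding coords_def
  by (rule bary_class[OF weight_pos]) (rule someI[of "\<lambda>y. y \<in> glued_class (oglue n w) x" x],
      rule glued_class_refl)

lemma orientedE:
  assumes "X \<in> oriented_paths n w"
  obtains T r p where "X = (T, r)" "oriented_path n w T r p"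
proof -
  obtain T r where X: "X = (T, r)" by (cases X)
  with assms obtain p where "oriented_path n w T r p"
    using oriented_path_exists[OF weight_pos] by blast
  with that X show thesis .
qed

lemma inj_on_side: "X \<in> oriented_paths n w \<Longrightarrow> inj_on (side n X) (oedges X)"
  by (erule orientedE) (simp add: oriented_path.inj_on_side)

lemma side_image: "X \<in> oriented_paths n w \<Longrightarrow> side n X ` oedges X \<in> heavy_complex"
  by (erule orientedE) (simp add: oriented_path.side_image)

lemma bary_side: "X \<in> oriented_paths n w \<Longrightarrow> e \<in> oedges X \<Longrightarrow> bary n (X, l) (side n X e) = l e"
  by (erule orientedE) (simp add: oriented_path.bary_side)

lemma bary_in_realization:
  assumes "X \<in> oriented_paths n w" "l \<in> std_simplex (oedges X)"
  shows "bary n (X, l) \<in> (\<Union>\<sigma>\<in>heavy_complex. std_simplex \<sigma>)"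
proof -
  obtain T r p where X: "X = (T, r)" and "oriented_path n w T r p"
    using assms(1) by (rule orientedE)
  then have "bary n (X, l) \<in> std_simplex (side n X ` oedges X)"
    using assms(2) by (simp add: oriented_path.bary_in_std_simplex)
  with side_image[OF assms(1)] show ?thesis by blast
qed

text \<open>Both points are glued to the same chain point, the one built from their common
  coordinates.\<close>

lemma glued_class_eq_of_bary_eq:
  assumes X: "X \<in> oriented_paths n w" "l \<in> std_simplex (oedges X)"
    and X': "X' \<in> oriented_paths n w" "l' \<in> std_simplex (oedges X')"
    and eq: "bary n (X, l) = bary n (X', l')"
  shows "glued_class (oglue n w) (X, l) = glued_class (oglue n w) (X', l')"
proof -
  have "glued_class (oglue n w) (X, l)
      = glued_class (oglue n w) (chain_point n {A. bary n (X, l) A \<noteq> 0} (bary n (X, l)))"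
    if "X \<in> oriented_paths n w" "l \<in> std_simplex (oedges X)" for X l
  proof -
    obtain T r p where *: "X = (T, r)" "oriented_path n w T r p"
      using \<open>X \<in> oriented_paths n w\<close> by (rule orientedE)
    then show ?thesis
      using oriented_path.normal_form(1)[OF *(2)] that(2) by (intro glued_class_glue) simp
  qed
  from this[OF X] this[OF X'] show ?thesis unfolding eq by simp
qed

lemma chain_point_in_topspace:
  assumes "\<sigma> \<in> heavy_complex" "f \<in> std_simplex \<sigma>"
  shows "glued_class (oglue n w) (chain_point n \<sigma> f) \<in> topspace (oriented_Delta n w)"
  unfolding oriented_Delta_def chain_point_def
  using chain_path_oriented[OF weight_pos assms(1)] chain_point_props(1)[OF weight_pos assms]
  by (rule glued_class_in_topspace)

lemma inj_on_coords: "inj_on (coords n) (topspace (oriented_Delta n w))"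
proof (rule inj_onI)
  fix x y assume "x \<in> topspace (oriented_Delta n w)" "y \<in> topspace (oriented_Delta n w)"
    and eq: "coords n x = coords n y"
  then obtain X l X' l' where X: "X \<in> oriented_paths n w" "l \<in> std_simplex (oedges X)"
      and X': "X' \<in> oriented_paths n w" "l' \<in> std_simplex (oedges X')"
      and xy: "x = glued_class (oglue n w) (X, l)" "y = glued_class (oglue n w) (X', l')"
    unfolding oriented_Delta_def topspace_glued_space_iff by blast
  then show "x = y"
    using glued_class_eq_of_bary_eq[OF X X'] eq by (simp only: coords_class)
qed

lemma coords_image: "coords n ` topspace (oriented_Delta n w) = (\<Union>\<sigma>\<in>heavy_complex. std_simplex \<sigma>)"
proof
  show "coords n ` topspace (oriented_Delta n w) \<subseteq> (\<Union>\<sigma>\<in>heavy_complex. std_simplex \<sigma>)"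
  proof
    fix f assume "f \<in> coords n ` topspace (oriented_Delta n w)"
    then obtain X l where X: "X \<in> oriented_paths n w" "l \<in> std_simplex (oedges X)"
        and "f = coords n (glued_class (oglue n w) (X, l))"
      unfolding oriented_Delta_def by (auto simp: topspace_glued_space_iff)
    then show "f \<in> (\<Union>\<sigma>\<in>heavy_complex. std_simplex \<sigma>)"
      using bary_in_realization[OF X] by (simp only: coords_class)
  qed
  show "(\<Union>\<sigma>\<in>heavy_complex. std_simplex \<sigma>) \<subseteq> coords n ` topspace (oriented_Delta n w)"
  proof
    fix f assume "f \<in> (\<Union>\<sigma>\<in>heavy_complex. std_simplex \<sigma>)"
    then obtain \<sigma> where \<sigma>: "\<sigma> \<in> heavy_complex" "f \<in> std_simplex \<sigma>" by blast
    then have "f = coords n (glued_class (oglue n w) (chain_point n \<sigma> f))"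
      using chain_point_props(2)[OF weight_pos \<sigma>] by (simp add: coords_class)
    then show "f \<in> coords n ` topspace (oriented_Delta n w)"
      using chain_point_in_topspace[OF \<sigma>] by (rule image_eqI)
  qed
qed

lemma continuous_map_coords:
  "continuous_map (oriented_Delta n w) (realization heavy_complex) (coords n)"
  unfolding oriented_Delta_def
proof (rule continuous_map_glued_space)
  fix X assume X: "X \<in> oriented_paths n w"
  have "continuous_on (std_simplex (oedges X)) (\<lambda>l. bary n (X, l))"
    unfolding bary_def
    by (intro continuous_on_coordinatewise_then_product) (simp add: continuous_on_sum_coordinates)
  then have "continuous_on (std_simplex (oedges X)) (\<lambda>l. coords n (glued_class (oglue n w) (X, l)))"
    by (simp only: coords_class)
  moreover have "(\<lambda>l. coords n (glued_class (oglue n w) (X, l))) \<in>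
      std_simplex (oedges X) \<rightarrow> (\<Union>\<sigma>\<in>heavy_complex. std_simplex \<sigma>)"
    using bary_in_realization[OF X] by (simp only: coords_class Pi_iff) blast
  ultimately show "continuous_map (top_of_set (std_simplex (oedges X))) (realization heavy_complex)
      (\<lambda>l. coords n (glued_class (oglue n w) (X, l)))"
    unfolding realization_def by (subst continuous_map_in_subtopology) auto
qed

text \<open>On each simplex \<sigma> the inverse of \<open>coords\<close> is the explicit continuous
  map given by \<open>chain_point\<close>. The image of \<open>U\<close> meets \<sigma> in the
  preimage of \<open>U\<close> under that map, and openness may be tested simplex by
  simplex.\<close>

lemma open_map_coords: "open_map (oriented_Delta n w) (realization heavy_complex) (coords n)"
  unfolding open_map_def
proof (intro allI impI)
  fix U assume U: "openin (oriented_Delta n w) U"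
  then have sub: "U \<subseteq> topspace (oriented_Delta n w)" by (rule openin_subset)
  show "openin (realization heavy_complex) (coords n ` U)"
  proof (rule openin_realization[OF finite_heavy_complex])
    show "coords n ` U \<subseteq> (\<Union>\<sigma>\<in>heavy_complex. std_simplex \<sigma>)"
      using sub coords_image by blast
  next
    fix \<sigma> assume \<sigma>: "\<sigma> \<in> heavy_complex"
    let ?g = "\<lambda>f. glued_class (oglue n w) (chain_point n \<sigma> f)"
    \<comment> \<open>Global injectivity of \<open>coords\<close> is essential here:
      \<open>f\<close> might otherwise be the coordinates of a point of \<open>U\<close> other than
      its own chain point.\<close>
    have iff: "?g f \<in> U \<longleftrightarrow> f \<in> coords n ` U" if f: "f \<in> std_simplex \<sigma>" for f
    proof -
      have "coords n (?g f) = f"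
        using chain_point_props(2)[OF weight_pos \<sigma> f] by (simp add: coords_class)
      then show ?thesis
        using inj_on_image_mem_iff[OF inj_on_coords chain_point_in_topspace[OF \<sigma> f] sub] by simp
    qed
    have "continuous_on (std_simplex \<sigma>) (lift_coords n \<sigma>)"
    proof (rule continuous_on_coordinatewise_then_product)
      fix e
      show "continuous_on (std_simplex \<sigma>) (\<lambda>f. lift_coords n \<sigma> f e)"
        unfolding lift_coords_def
        by (cases "e \<in> oedges (chain_path \<sigma>)")
          (simp_all add: continuous_on_coordinate)
    qed
    then have "continuous_map (top_of_set (std_simplex \<sigma>))
        (top_of_set (std_simplex (oedges (chain_path \<sigma>)))) (lift_coords n \<sigma>)"
      using chain_point_props(1)[OF weight_pos \<sigma>] by (subst continuous_map_in_subtopology) auto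
    moreover have "continuous_map (top_of_set (std_simplex (oedges (chain_path \<sigma>))))
        (oriented_Delta n w) (\<lambda>l. glued_class (oglue n w) (chain_path \<sigma>, l))"
      unfolding oriented_Delta_def
      by (rule continuous_map_glued_class[OF chain_path_oriented[OF weight_pos \<sigma>]])
    ultimately have "continuous_map (top_of_set (std_simplex \<sigma>)) (oriented_Delta n w)
        ((\<lambda>l. glued_class (oglue n w) (chain_path \<sigma>, l)) \<circ> lift_coords n \<sigma>)"
      by (rule continuous_map_compose)
    then have "continuous_map (top_of_set (std_simplex \<sigma>)) (oriented_Delta n w) ?g"
      by (simp only: comp_def chain_point_def)
    from openin_continuous_map_preimage[OF this U]
    have "openin (top_of_set (std_simplex \<sigma>)) {f \<in> std_simplex \<sigma>. ?g f \<in> U}"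
      by (simp only: topspace_euclidean_subtopology)
    moreover have "{f \<in> std_simplex \<sigma>. ?g f \<in> U} = std_simplex \<sigma> \<inter> coords n ` U"
      using iff by blast
    ultimately show "openin (top_of_set (std_simplex \<sigma>)) (std_simplex \<sigma> \<inter> coords n ` U)"
      by simp
  qed
qed

lemma homeomorphic_map_coords:
  "homeomorphic_map (oriented_Delta n w) (realization heavy_complex) (coords n)"
  using continuous_map_coords open_map_coords _ inj_on_coords
proof (rule bijective_open_imp_homeomorphic_map)
  show "coords n ` topspace (oriented_Delta n w) = topspace (realization heavy_complex)"
    unfolding coords_image realization_def by simp
qed

lemma simplicial_iso_coords:
  "simplicial_iso (oriented_paths n w) oedges (oglue n w) heavy_complex (coords n)"
  unfolding simplicial_iso_def
proof (intro conjI exI[of _ "side n"] ballI impI)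
  show "homeomorphic_map (glued_space (oriented_paths n w) oedges (oglue n w))
      (realization heavy_complex) (coords n)"
    using homeomorphic_map_coords unfolding oriented_Delta_def .
next
  fix \<sigma> assume "\<sigma> \<in> heavy_complex"
  then show "\<exists>X\<in>oriented_paths n w. oedges X \<noteq> {} \<and> side n X ` oedges X = \<sigma>"
    using chain_path_oriented[OF weight_pos] side_chain_path_image[OF weight_pos]
      oriented_edges_nonempty by (metis prod.collapse)
qed (simp_all add: inj_on_side side_image coords_class bary_side)

end

section \<open>The double cover\<close>

lemma glue_of_oglue:
  assumes "(x, y) \<in> oglue n w"
  shows "((fst (fst x), snd x), (fst (fst y), snd y)) \<in> glue n w"
proof -
  obtain T r l T' r' l' where x: "x = ((T, r), l)" and y: "y = ((T', r'), l')"
    by (metis prod.exhaust)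
  have "\<exists>F c. contraction n T F T' c \<and> (\<forall>e\<in>F. l e = 0) \<and> (\<forall>e\<in>edges T - F. l' (c ` e) = l e)"
    using assms unfolding x y oglue_def by auto
  moreover have "T \<in> stable_trees n w" "T' \<in> stable_trees n w"
      "l \<in> std_simplex (edges T)" "l' \<in> std_simplex (edges T')"
    using assms unfolding x y oglue_def oriented_paths_def by simp_all
  ultimately show ?thesis unfolding x y glue_def by simp
qed

text \<open>Every identification of oriented paths is one of the underlying trees, so all members of
  the union defining \<open>forget\<close> coincide.\<close>

lemma forget_class:
  "forget n w (glued_class (oglue n w) ((T, r), l)) = glued_class (glue n w) (T, l)"
proof -
  let ?x = "((T, r), l)"
  have "glued_class (glue n w) (fst (fst y), snd y) = glued_class (glue n w) (T, l)"
    if "y \<in> glued_class (oglue n w) ?x" for y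
    using that
  proof (induction rule: glued_class_induct)
    case (forward y z)
    then show ?case using glued_class_glue[OF glue_of_oglue[OF forward.hyps(2)]] by simp
  next
    case (backward y z)
    then show ?case using glued_class_glue[OF glue_of_oglue[OF backward.hyps(2)]] by simp
  qed simp
  then have "(\<lambda>((T, r), l). glued_class (glue n w) (T, l)) ` glued_class (oglue n w) ?x
      = (\<lambda>_. glued_class (glue n w) (T, l)) ` glued_class (oglue n w) ?x"
    by (intro image_cong refl) (simp add: case_prod_beta)
  moreover have "glued_class (oglue n w) ?x \<noteq> {}" using glued_class_refl by blast
  ultimately show ?thesis unfolding forget_def by (simp only: UN_constant if_False image_constant_conv) simp
qed

section \<open>Reversal and complements\<close>

lemma (in oriented_path) side_opposite:
  "e \<in> edges T \<Longrightarrow> side n (T, r \<circ> opposite) e = {1..n} - side n (T, r) e"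
  by (rule side_reversed) simp_all

text \<open>Complementation in \<open>{1..n}\<close> is an involution only on subsets of
  \<open>{1..n}\<close>, hence the restriction on \<open>A\<close>.\<close>

lemma (in oriented_path) bary_opposite:
  assumes "A \<subseteq> {1..n}"
  shows "bary n ((T, r \<circ> opposite), l) A = bary n ((T, r), l) ({1..n} - A)"
proof -
  have "side n (T, r \<circ> opposite) e = A \<longleftrightarrow> side n (T, r) e = {1..n} - A" if "e \<in> edges T" for e
  proof -
    have "side n (T, r) e \<subseteq> {1..n}" unfolding side_def by blast
    with assms show ?thesis unfolding side_opposite[OF that] by blast
  qed
  then have "{e \<in> edges T. side n (T, r \<circ> opposite) e = A} = {e \<in> edges T. side n (T, r) e = {1..n} - A}"
    by blast
  then show ?thesis unfolding bary_def by simp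
qed

text \<open>A set comparable with its complement is empty or everything, but here both it and its
  complement have positive weight.\<close>

lemma complement_not_both_in_chain:
  assumes \<sigma>: "\<sigma> \<in> order_complex (heavy_subsets n w)" and A: "A \<in> \<sigma>"
  shows "{1..n} - A \<notin> \<sigma>"
proof
  assume Ac: "{1..n} - A \<in> \<sigma>"
  have "\<sigma> \<subseteq> heavy_subsets n w" and chain: "chain\<^sub>\<subseteq> \<sigma>"
    using \<sigma> unfolding order_complex_def chains_def by auto
  then have "A \<in> heavy_subsets n w" using A by blast
  then have heavy: "A \<subseteq> {1..n}" "sum w A > 1" "sum w ({1..n} - A) > 1"
    unfolding heavy_subsets_def by simp_all
  have "A \<subseteq> {1..n} - A \<or> {1..n} - A \<subseteq> A"
    using bspec[OF bspec[OF chain[unfolded chain_subset_def] A] Ac] .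
  then show False
  proof
    assume "A \<subseteq> {1..n} - A"
    then have "A = {}" by blast
    with heavy(2) show False by simp
  next
    assume "{1..n} - A \<subseteq> A"
    then have "{1..n} - A = {}" by blast
    with heavy(3) show False by (simp only: sum.empty)
  qed
qed

section \<open>Lifting identifications to orientations\<close>

locale path_weights = weights +
  assumes path_space: "path_space n w"
begin

abbreviation "oriented_class X l \<equiv> glued_class (oglue n w) (X, l)"
abbreviation "class T l \<equiv> glued_class (glue n w) (T, l)"

text \<open>This is path lifting in combinatorial form: an orientation is carried along the zigzag,
  pushed through each contraction met forwards and pulled back through each one met
  backwards.\<close>

lemma lift_class:
  assumes y: "y \<in> glued_class (glue n w) (T, l)"
    and T: "(T, r) \<in> oriented_paths n w" "l \<in> std_simplex (edges T)"
  shows "\<exists>r'. (fst y, r') \<in> oriented_paths n w \<and> snd y \<in> std_simplex (edges (fst y)) \<and>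
    oriented_class (fst y, r') (snd y) = oriented_class (T, r) l"
  using y
proof (induction rule: glued_class_induct)
  case refl
  show ?case using T by auto
next
  case (forward y z)
  obtain T1 l1 T2 l2 where y: "y = (T1, l1)" and z: "z = (T2, l2)" by (cases y, cases z)
  obtain r1 where r1: "(T1, r1) \<in> oriented_paths n w"
      "oriented_class (T1, r1) l1 = oriented_class (T, r) l"
    using forward.IH unfolding y by auto
  obtain F c where T2: "T2 \<in> stable_trees n w" and l: "l1 \<in> std_simplex (edges T1)" "l2 \<in> std_simplex (edges T2)"
      and con: "contraction n T1 F T2 c" and F: "\<forall>e\<in>F. l1 e = 0" "\<forall>e\<in>edges T1 - F. l2 (c ` e) = l1 e"
    using forward.hyps(2) unfolding y z glue_def by auto
  have r2: "(T2, c \<circ> r1) \<in> oriented_paths n w"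
    using push_orientation[OF weight_pos path_space r1(1) T2 std_simplex_nonempty[OF l(2)] con] .
  have "(((T1, r1), l1), ((T2, c \<circ> r1), l2)) \<in> oglue n w"
    using r1(1) l(1) r2 l(2) con by (rule oglueI) (use F in auto)
  then have "oriented_class (T2, c \<circ> r1) l2 = oriented_class (T, r) l"
    using glued_class_glue r1(2) by metis
  with r2 l(2) show ?case unfolding z by auto
next
  case (backward y z)
  obtain T1 l1 T2 l2 where y: "y = (T1, l1)" and z: "z = (T2, l2)" by (cases y, cases z)
  obtain r1 where r1: "(T1, r1) \<in> oriented_paths n w"
      "oriented_class (T1, r1) l1 = oriented_class (T, r) l"
    using backward.IH unfolding y by auto
  obtain F c where T2: "T2 \<in> stable_trees n w" and l: "l1 \<in> std_simplex (edges T1)" "l2 \<in> std_simplex (edges T2)"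
      and con: "contraction n T2 F T1 c" and F: "\<forall>e\<in>F. l2 e = 0" "\<forall>e\<in>edges T2 - F. l1 (c ` e) = l2 e"
    using backward.hyps(2) unfolding y z glue_def by auto
  obtain r2 where r2: "(T2, r2) \<in> oriented_paths n w" "r1 = c \<circ> r2"
    using pull_orientation[OF weight_pos path_space r1(1) T2 con] by blast
  have "(((T2, r2), l2), ((T1, r1), l1)) \<in> oglue n w"
    using r2(1) l(2) r1(1) l(1) con by (rule oglueI) (use F r2(2) in auto)
  then have "oriented_class (T2, r2) l2 = oriented_class (T, r) l"
    using glued_class_glue r1(2) by metis
  with r2(1) l(2) show ?case unfolding z by auto
qed

text \<open>A point over the class of \<open>(T, l)\<close> can be represented on \<open>T\<close>
  itself by lifting the identifications, and \<open>T\<close> has only the orientations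
  \<open>r\<close> and its reverse.\<close>

lemma forget_eq_iff:
  assumes T: "(T, r) \<in> oriented_paths n w" and l: "l \<in> std_simplex (edges T)"
    and x: "x \<in> topspace (oriented_Delta n w)"
  shows "forget n w x = class T l \<longleftrightarrow>
    x = oriented_class (T, r) l \<or> x = oriented_class (T, r \<circ> opposite) l"
proof
  assume eq: "forget n w x = class T l"
  obtain T' r' l' where T': "(T', r') \<in> oriented_paths n w" "l' \<in> std_simplex (edges T')"
      and x': "x = oriented_class (T', r') l'"
    using x unfolding oriented_Delta_def topspace_glued_space_iff by auto
  have "class T l = class T' l'" using eq unfolding x' forget_class by simp
  then have "(T, l) \<in> class T' l'" by (simp add: glued_class_eq_iff[symmetric])
  from lift_class[OF this T']
  obtain r'' where "(T, r'') \<in> oriented_paths n w" "oriented_class (T, r'') l = x"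
    unfolding x' fst_conv snd_conv by blast
  then show "x = oriented_class (T, r) l \<or> x = oriented_class (T, r \<circ> opposite) l"
    using orientation_cases[OF T] by blast
qed (auto simp: forget_class)

lemma topspace_Delta_cases:
  assumes "y \<in> topspace (Delta n w)"
  obtains T r l where "(T, r) \<in> oriented_paths n w" "l \<in> std_simplex (edges T)" "y = class T l"
proof -
  obtain T l where T: "T \<in> stable_trees n w" "l \<in> std_simplex (edges T)" "y = class T l"
    using assms unfolding Delta_def topspace_glued_space_iff by auto
  then obtain r where "(T, r) \<in> oriented_paths n w"
    using orientation_exists[OF path_space T(1) std_simplex_nonempty] by blast
  with that T show thesis by blast
qed

lemma topspace_oriented_Delta_cases:
  assumes "x \<in> topspace (oriented_Delta n w)"
  obtains T r l where "(T, r) \<in> oriented_paths n w" "l \<in> std_simplex (edges T)"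
    "x = oriented_class (T, r) l"
proof -
  obtain X l where X: "X \<in> oriented_paths n w" "l \<in> std_simplex (oedges X)" "x = oriented_class X l"
    using assms unfolding oriented_Delta_def topspace_glued_space_iff by blast
  moreover obtain T r where "X = (T, r)" by (cases X)
  ultimately show thesis using that by simp
qed

lemma oriented_class_in_topspace:
  "(T, r) \<in> oriented_paths n w \<Longrightarrow> l \<in> std_simplex (edges T) \<Longrightarrow>
    oriented_class (T, r) l \<in> topspace (oriented_Delta n w)"
  unfolding oriented_Delta_def by (rule glued_class_in_topspace) simp_all

lemma continuous_map_forget: "continuous_map (oriented_Delta n w) (Delta n w) (forget n w)"
  unfolding oriented_Delta_def
proof (rule continuous_map_glued_space)
  fix X assume "X \<in> oriented_paths n w"
  then obtain T r where X: "X = (T, r)" and T: "T \<in> stable_trees n w"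
    unfolding oriented_paths_def by auto
  show "continuous_map (top_of_set (std_simplex (oedges X))) (Delta n w)
      (\<lambda>l. forget n w (glued_class (oglue n w) (X, l)))"
    using continuous_map_glued_class[OF T, of edges "glue n w"]
    unfolding X forget_class Delta_def by simp
qed

lemma forget_image: "forget n w ` topspace (oriented_Delta n w) = topspace (Delta n w)"
proof
  show "forget n w ` topspace (oriented_Delta n w) \<subseteq> topspace (Delta n w)"
    using continuous_map_forget by (rule continuous_map_image_subset_topspace)
  show "topspace (Delta n w) \<subseteq> forget n w ` topspace (oriented_Delta n w)"
  proof
    fix y assume "y \<in> topspace (Delta n w)"
    then obtain T r l where T: "(T, r) \<in> oriented_paths n w" "l \<in> std_simplex (edges T)"
        and y: "y = class T l"
      by (rule topspace_Delta_cases)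
    show "y \<in> forget n w ` topspace (oriented_Delta n w)"
      using forget_class[of n w T r l, symmetric] oriented_class_in_topspace[OF T]
      unfolding y by (rule image_eqI)
  qed
qed

text \<open>In the simplex of an unoriented tree, the image of \<open>U\<close> is seen as the union
  of the two open sets in which the oriented copies of that simplex meet \<open>U\<close>.\<close>

lemma open_map_forget: "open_map (oriented_Delta n w) (Delta n w) (forget n w)"
  unfolding open_map_def
proof (intro allI impI)
  fix U assume U: "openin (oriented_Delta n w) U"
  then have sub: "U \<subseteq> topspace (oriented_Delta n w)" by (rule openin_subset)
  have "openin (top_of_set (std_simplex (edges T)))
      {l \<in> std_simplex (edges T). class T l \<in> forget n w ` U}"
    if T: "T \<in> stable_trees n w" for T
  proof (cases "edges T = {}")
    case True
    then have "std_simplex (edges T) = {}" using std_simplex_nonempty by blast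
    then show ?thesis by simp
  next
    case False
    then obtain r where r: "(T, r) \<in> oriented_paths n w"
      using orientation_exists[OF path_space T] by blast
    let ?P = "\<lambda>r. {l \<in> std_simplex (edges T). oriented_class (T, r) l \<in> U}"
    have "openin (top_of_set (std_simplex (edges T))) (?P r)"
      if "(T, r) \<in> oriented_paths n w" for r
      using U that unfolding oriented_Delta_def openin_glued_space_iff by fastforce
    then have "openin (top_of_set (std_simplex (edges T))) (?P r \<union> ?P (r \<circ> opposite))"
      using r opposite_oriented[OF r] by (intro openin_Un)
    moreover have "class T l \<in> forget n w ` U \<longleftrightarrow>
        oriented_class (T, r) l \<in> U \<or> oriented_class (T, r \<circ> opposite) l \<in> U"
      if l: "l \<in> std_simplex (edges T)" for l
    proof
      assume "class T l \<in> forget n w ` U"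
      then obtain x where "x \<in> U" "forget n w x = class T l" by auto
      then show "oriented_class (T, r) l \<in> U \<or> oriented_class (T, r \<circ> opposite) l \<in> U"
        using forget_eq_iff[OF r l] sub by blast
    next
      assume "oriented_class (T, r) l \<in> U \<or> oriented_class (T, r \<circ> opposite) l \<in> U"
      then show "class T l \<in> forget n w ` U"
        using forget_class[of n w T _ l, symmetric] by (auto intro: image_eqI)
    qed
    then have "{l \<in> std_simplex (edges T). class T l \<in> forget n w ` U} = ?P r \<union> ?P (r \<circ> opposite)"
      by blast
    ultimately show ?thesis by (simp only:)
  qed
  moreover have "forget n w ` U \<subseteq> topspace (Delta n w)" using sub forget_image by blast
  ultimately show "openin (Delta n w) (forget n w ` U)"
    unfolding Delta_def openin_glued_space_iff by blast
qed

section \<open>The two points of a fibre\<close>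

lemma coords_opposite:
  assumes "(T, r) \<in> oriented_paths n w" "B \<subseteq> {1..n}"
  shows "coords n (oriented_class (T, r \<circ> opposite) l) B = coords n (oriented_class (T, r) l) ({1..n} - B)"
proof -
  obtain p where "oriented_path n w T r p"
    using oriented_path_exists[OF weight_pos assms(1)] .
  then show ?thesis
    using oriented_path.bary_opposite[OF _ assms(2)] by (simp only: coords_class)
qed

lemma coords_support:
  assumes "x \<in> topspace (oriented_Delta n w)"
  obtains \<sigma> where "\<sigma> \<in> heavy_complex" "coords n x \<in> std_simplex \<sigma>"
proof -
  have "coords n x \<in> coords n ` topspace (oriented_Delta n w)" using assms by (rule imageI)
  then show thesis using that unfolding coords_image by blast
qed

lemma coords_complement:
  assumes x: "x \<in> topspace (oriented_Delta n w)" and B: "coords n x B \<noteq> 0"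
  shows "coords n x ({1..n} - B) = 0"
proof -
  obtain \<sigma> where \<sigma>: "\<sigma> \<in> heavy_complex" "coords n x \<in> std_simplex \<sigma>"
    using coords_support[OF x] .
  have zero: "A \<notin> \<sigma> \<Longrightarrow> coords n x A = 0" for A
    using \<sigma>(2) unfolding std_simplex_def by simp
  then have "B \<in> \<sigma>" using B by blast
  then have "{1..n} - B \<notin> \<sigma>" by (rule complement_not_both_in_chain[OF \<sigma>(1)])
  then show ?thesis by (rule zero)
qed

lemma coords_nonzero:
  assumes x: "x \<in> topspace (oriented_Delta n w)"
  obtains A where "A \<subseteq> {1..n}" "coords n x A \<noteq> 0"
proof -
  obtain \<sigma> where \<sigma>: "\<sigma> \<in> heavy_complex" "coords n x \<in> std_simplex \<sigma>"
    using coords_support[OF x] .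
  then have "sum (coords n x) \<sigma> \<noteq> 0" unfolding std_simplex_def by simp
  then obtain A where "A \<in> \<sigma>" "coords n x A \<noteq> 0" by (meson sum.neutral)
  moreover have "A \<subseteq> {1..n}"
    using \<open>A \<in> \<sigma>\<close> \<sigma>(1) unfolding order_complex_def chains_def heavy_subsets_def by auto
  ultimately show thesis using that by blast
qed

text \<open>Reversal is described at a single point instead of as a map on classes. The other point
  of the fibre, its coordinates and the exhaustion of the fibre are all that the covering argument
  uses.\<close>

lemma swap_exists:
  assumes "x \<in> topspace (oriented_Delta n w)"
  obtains x' where "x' \<in> topspace (oriented_Delta n w)" "forget n w x' = forget n w x"
    "\<And>B. B \<subseteq> {1..n} \<Longrightarrow> coords n x' B = coords n x ({1..n} - B)"
    "\<And>z. z \<in> topspace (oriented_Delta n w) \<Longrightarrow> forget n w z = forget n w x \<Longrightarrow> z = x \<or> z = x'"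
proof -
  obtain T r l where T: "(T, r) \<in> oriented_paths n w" "l \<in> std_simplex (edges T)"
      and x: "x = oriented_class (T, r) l"
    using assms by (rule topspace_oriented_Delta_cases)
  show thesis
  proof (rule that)
    show "oriented_class (T, r \<circ> opposite) l \<in> topspace (oriented_Delta n w)"
      using opposite_oriented[OF T(1)] T(2) by (rule oriented_class_in_topspace)
    show "forget n w (oriented_class (T, r \<circ> opposite) l) = forget n w x"
      unfolding x forget_class ..
    show "coords n (oriented_class (T, r \<circ> opposite) l) B = coords n x ({1..n} - B)"
      if "B \<subseteq> {1..n}" for B
      unfolding x using T(1) that by (rule coords_opposite)
    show "z = x \<or> z = oriented_class (T, r \<circ> opposite) l"
      if "z \<in> topspace (oriented_Delta n w)" "forget n w z = forget n w x" for z
      using forget_eq_iff[OF T that(1)] that(2) unfolding x forget_class by simp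
  qed
qed

text \<open>The two points differ: where \<open>x\<close> has a nonzero coordinate \<open>A\<close>,
  the coordinate of \<open>x'\<close> is that of \<open>x\<close> at the complement of
  \<open>A\<close>, which is 0.\<close>

lemma fibre_card:
  assumes "y \<in> topspace (Delta n w)"
  shows "card {x \<in> topspace (oriented_Delta n w). forget n w x = y} = 2"
proof -
  have "y \<in> forget n w ` topspace (oriented_Delta n w)"
    using assms by (simp only: forget_image)
  then obtain x where x: "x \<in> topspace (oriented_Delta n w)" and y: "y = forget n w x"
    by (auto elim: imageE)
  obtain x' where x': "x' \<in> topspace (oriented_Delta n w)" "forget n w x' = forget n w x"
      and swap: "\<And>B. B \<subseteq> {1..n} \<Longrightarrow> coords n x' B = coords n x ({1..n} - B)"
      and only: "\<And>z. z \<in> topspace (oriented_Delta n w) \<Longrightarrow> forget n w z = forget n w x \<Longrightarrow> z = x \<or> z = x'"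
    using swap_exists[OF x] by metis
  obtain A where A: "A \<subseteq> {1..n}" "coords n x A \<noteq> 0"
    using coords_nonzero[OF x] .
  then have "coords n x' A = 0" using swap[OF A(1)] coords_complement[OF x A(2)] by simp
  with A(2) have "x \<noteq> x'" by auto
  moreover have "{x \<in> topspace (oriented_Delta n w). forget n w x = y} = {x, x'}"
    unfolding y using x x' only by blast
  ultimately show ?thesis by simp
qed

section \<open>Open stars of vertices as the sheets of the cover\<close>

definition star :: "nat set \<Rightarrow> (otree \<times> (nat set \<Rightarrow> real)) set set" where
  "star B = {x \<in> topspace (oriented_Delta n w). coords n x B \<noteq> 0}"

lemma openin_star: "openin (oriented_Delta n w) (star B)"
proof -
  let ?Z = "\<Union>\<sigma>\<in>heavy_complex. std_simplex \<sigma>"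
  have "open (- {0 :: real})" by (intro open_Compl closed_singleton)
  then have "openin (top_of_set ?Z) (?Z \<inter> (\<lambda>f. f B) -` (- {0}))"
    by (rule continuous_openin_preimage_gen[OF continuous_on_coordinate])
  then have "openin (realization heavy_complex) (?Z \<inter> (\<lambda>f. f B) -` (- {0}))"
    unfolding realization_def .
  from openin_continuous_map_preimage[OF continuous_map_coords this]
  have "openin (oriented_Delta n w)
      {x \<in> topspace (oriented_Delta n w). coords n x \<in> ?Z \<inter> (\<lambda>f. f B) -` (- {0})}" .
  moreover have "{x \<in> topspace (oriented_Delta n w). coords n x \<in> ?Z \<inter> (\<lambda>f. f B) -` (- {0})} = star B"
    unfolding star_def coords_image[symmetric] by auto
  ultimately show ?thesis by (simp only:)
qed

lemma disjnt_star: "disjnt (star B) (star ({1..n} - B))"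
proof -
  have "x \<notin> star ({1..n} - B)" if "x \<in> star B" for x
    using that coords_complement[of x B] unfolding star_def by simp
  then show ?thesis unfolding disjnt_iff by blast
qed

text \<open>Passing to the other point of the fibre moves the star of \<open>B\<close> into the star
  of its complement and does not change the image.\<close>

lemma forget_star_subset:
  assumes "B \<subseteq> {1..n}"
  shows "forget n w ` star B \<subseteq> forget n w ` star ({1..n} - B)"
proof
  fix y assume "y \<in> forget n w ` star B"
  then obtain x where x: "x \<in> topspace (oriented_Delta n w)" "coords n x B \<noteq> 0" "y = forget n w x"
    unfolding star_def by blast
  obtain x' where x': "x' \<in> topspace (oriented_Delta n w)" "forget n w x' = forget n w x"
      "coords n x' ({1..n} - B) = coords n x ({1..n} - ({1..n} - B))"
    using swap_exists[OF x(1)] by (metis Diff_subset)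
  have "{1..n} - ({1..n} - B) = B" by (rule double_diff[OF assms order_refl])
  with x x' have "x' \<in> star ({1..n} - B)" unfolding star_def by simp
  with x(3) x'(2) show "y \<in> forget n w ` star ({1..n} - B)" by (metis image_eqI)
qed

lemma forget_star:
  assumes "B \<subseteq> {1..n}"
  shows "forget n w ` star ({1..n} - B) = forget n w ` star B"
proof -
  have "{1..n} - ({1..n} - B) = B" by (rule double_diff[OF assms order_refl])
  then have "forget n w ` star ({1..n} - B) \<subseteq> forget n w ` star B"
    using forget_star_subset[of "{1..n} - B"] by (simp only: Diff_subset)
  then show ?thesis using forget_star_subset[OF assms] by (rule equalityI)
qed

text \<open>A point with the same image as some \<open>v\<close> in the star of \<open>B\<close> is
  either \<open>v\<close> or its reversal, and the latter lies in the star of the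
  complement.\<close>

lemma forget_preimage_star:
  assumes B: "B \<subseteq> {1..n}"
  shows "{x \<in> topspace (oriented_Delta n w). forget n w x \<in> forget n w ` star B}
    = star B \<union> star ({1..n} - B)"
proof (intro equalityI subsetI)
  fix x assume "x \<in> {x \<in> topspace (oriented_Delta n w). forget n w x \<in> forget n w ` star B}"
  then have x: "x \<in> topspace (oriented_Delta n w)" and fx: "forget n w x \<in> forget n w ` star B"
    by (simp_all only: mem_Collect_eq)
  from fx obtain v where v: "v \<in> star B" and eq: "forget n w x = forget n w v" by (rule imageE)
  have v': "v \<in> topspace (oriented_Delta n w)" "coords n v B \<noteq> 0" using v unfolding star_def by auto
  obtain v' where swap: "\<And>B. B \<subseteq> {1..n} \<Longrightarrow> coords n v' B = coords n v ({1..n} - B)"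
      and only: "\<And>z. z \<in> topspace (oriented_Delta n w) \<Longrightarrow> forget n w z = forget n w v \<Longrightarrow> z = v \<or> z = v'"
    using swap_exists[OF v'(1)] by metis
  show "x \<in> star B \<union> star ({1..n} - B)"
  proof (cases "x = v")
    case False
    then have "x = v'" using only x eq by blast
    moreover have "{1..n} - ({1..n} - B) = B" by (rule double_diff[OF B order_refl])
    ultimately have "coords n x ({1..n} - B) \<noteq> 0" using swap[of "{1..n} - B"] v'(2) by simp
    then show ?thesis using x unfolding star_def by simp
  qed (use v in simp)
next
  fix x assume "x \<in> star B \<union> star ({1..n} - B)"
  then have "forget n w x \<in> forget n w ` star B"
    using forget_star[OF B] by blast
  moreover have "x \<in> topspace (oriented_Delta n w)"
    using \<open>x \<in> star B \<union> star ({1..n} - B)\<close> unfolding star_def by blast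
  ultimately show "x \<in> {x \<in> topspace (oriented_Delta n w). forget n w x \<in> forget n w ` star B}"
    by blast
qed

text \<open>The only other point in the fibre of \<open>x\<close> has coordinate 0 at
  \<open>B\<close>, so it lies outside the star.\<close>

lemma inj_on_forget_star:
  assumes B: "B \<subseteq> {1..n}"
  shows "inj_on (forget n w) (star B)"
proof (rule inj_onI)
  fix x z assume "x \<in> star B" "z \<in> star B" and eq: "forget n w x = forget n w z"
  then have x: "x \<in> topspace (oriented_Delta n w)" "coords n x B \<noteq> 0"
    and z: "z \<in> topspace (oriented_Delta n w)" "coords n z B \<noteq> 0"
    unfolding star_def by auto
  obtain x' where swap: "\<And>B. B \<subseteq> {1..n} \<Longrightarrow> coords n x' B = coords n x ({1..n} - B)"
      and only: "\<And>z. z \<in> topspace (oriented_Delta n w) \<Longrightarrow> forget n w z = forget n w x \<Longrightarrow> z = x \<or> z = x'"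
    using swap_exists[OF x(1)] by metis
  have "coords n x' B = 0" using swap[OF B] coords_complement[OF x] by simp
  with z(2) have "z \<noteq> x'" by auto
  then show "x = z" using only[OF z(1)] eq by auto
qed

lemma homeomorphic_map_forget_star:
  assumes B: "B \<subseteq> {1..n}"
  shows "homeomorphic_map (subtopology (oriented_Delta n w) (star B))
    (subtopology (Delta n w) (forget n w ` star B)) (forget n w)"
proof (rule bijective_open_imp_homeomorphic_map)
  have star: "topspace (subtopology (oriented_Delta n w) (star B)) = star B"
    unfolding topspace_subtopology star_def by blast
  have sub: "forget n w ` star B \<subseteq> topspace (Delta n w)"
    using forget_image unfolding star_def by blast
  show "continuous_map (subtopology (oriented_Delta n w) (star B))
      (subtopology (Delta n w) (forget n w ` star B)) (forget n w)"
    using star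
    by (intro continuous_map_into_subtopology continuous_map_from_subtopology continuous_map_forget) auto
  show "open_map (subtopology (oriented_Delta n w) (star B))
      (subtopology (Delta n w) (forget n w ` star B)) (forget n w)"
    using star
    by (intro open_map_into_subtopology open_map_from_subtopology open_map_forget openin_star) auto
  show "forget n w ` topspace (subtopology (oriented_Delta n w) (star B))
      = topspace (subtopology (Delta n w) (forget n w ` star B))"
    unfolding star using sub by (simp add: inf.absorb2)
  show "inj_on (forget n w) (topspace (subtopology (oriented_Delta n w) (star B)))"
    unfolding star by (rule inj_on_forget_star[OF B])
qed

lemma evenly_covered:
  assumes "y \<in> topspace (Delta n w)"
  shows "\<exists>U. y \<in> U \<and> openin (Delta n w) U \<and>
    (\<exists>\<V>. \<Union>\<V> = {x \<in> topspace (oriented_Delta n w). forget n w x \<in> U} \<and>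
      (\<forall>V\<in>\<V>. openin (oriented_Delta n w) V) \<and> pairwise disjnt \<V> \<and>
      (\<forall>V\<in>\<V>. homeomorphic_map (subtopology (oriented_Delta n w) V)
         (subtopology (Delta n w) U) (forget n w)))"
proof -
  have "y \<in> forget n w ` topspace (oriented_Delta n w)"
    using assms by (simp only: forget_image)
  then obtain x where x: "x \<in> topspace (oriented_Delta n w)" and y: "y = forget n w x"
    by (auto elim: imageE)
  obtain A where A: "A \<subseteq> {1..n}" "coords n x A \<noteq> 0"
    using coords_nonzero[OF x] .
  \<comment> \<open>Any vertex \<open>A\<close> of the simplex carrying \<open>x\<close> with
    nonzero coordinate gives an evenly covered neighbourhood; its sheets are the stars of
    \<open>A\<close> and of its complement.\<close>
  let ?U = "forget n w ` star A" and ?V = "{star A, star ({1..n} - A)}"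
  have "y \<in> ?U" unfolding y using x A(2) unfolding star_def by blast
  moreover have "openin (Delta n w) ?U"
    using open_map_forget openin_star unfolding open_map_def by blast
  moreover have "\<Union>?V = {x \<in> topspace (oriented_Delta n w). forget n w x \<in> ?U}"
    unfolding forget_preimage_star[OF A(1)] by simp
  moreover have "\<forall>V\<in>?V. openin (oriented_Delta n w) V" using openin_star by blast
  moreover have "pairwise disjnt ?V"
    using disjnt_star[of A] by (auto simp: pairwise_insert disjnt_sym)
  moreover have "\<forall>V\<in>?V. homeomorphic_map (subtopology (oriented_Delta n w) V)
      (subtopology (Delta n w) ?U) (forget n w)"
    using homeomorphic_map_forget_star[OF A(1)] homeomorphic_map_forget_star[of "{1..n} - A"]
    unfolding forget_star[OF A(1)] by blast
  ultimately show ?thesis by blast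
qed

lemma double_cover_forget: "double_cover (oriented_Delta n w) (Delta n w) (forget n w)"
  unfolding double_cover_def
  by (intro conjI ballI continuous_map_forget forget_image evenly_covered fibre_card)

end

theorem theorem8p2:
  fixes n :: nat and w :: "nat \<Rightarrow> real"
  assumes "\<forall>i\<in>{1..n}. 0 < w i \<and> w i \<le> 1"
    and "(\<Sum>i=1..n. w i) > 2"
    and "path_space n w"
  shows "double_cover (oriented_Delta n w) (Delta n w) (forget n w) \<and>
    (\<exists>h. simplicial_iso (oriented_paths n w) oedges (oglue n w)
           (order_complex (heavy_subsets n w)) h)"
proof -
  interpret path_weights n w
    using assms by unfold_locales auto
  show ?thesis using double_cover_forget simplicial_iso_coords by blast
qed

end
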